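(* For any class $\mathcal{C}$ of families of p-bounded polynomials over an algebraically closed field $\mathbb{F}$, $\mathrm{Stable}\text{-}\mathcal{C}\subseteq\mathrm{Newton}\text{-}\mathcal{C}$. In particular $\mathrm{Stable}\text{-}\mathrm{VP}\subseteq\mathrm{Newton}\text{-}\mathrm{VP}$ and $\mathrm{Stable}\text{-}\mathrm{VNP}\subseteq\mathrm{Newton}\text{-}\mathrm{VNP}$.
   Context: A family $\{f_n\}$ is p-bounded if $f_n$ has $\mathsf{poly}(n)$ variables and degree $\mathsf{poly}(n)$. A linear projection of $f(y_1,\dots,y_m)$ is obtained by substituting for each $y_j$ an affine linear combination of new variables with coefficients in $\mathbb{F}$. $G=\mathrm{SL}(m,\mathbb{F})$ acts on $\mathbb{F}[x_1,\dots,x_m]$ by $(\sigma\cdot f)(\mathbf{x})=f(\sigma^{-1}\mathbf{x})$. The Zariski closure of the $G$-orbit of any $g$ contains a unique closed $G$-orbit; $f$ is a stable degeneration of $g$ if $f$ lies in that closed orbit. $\{f_n\}\in\mathrm{Stable}\text{-}\mathcal{C}$ if $\{f_n\}\in\mathcal{C}$ or there is $\{g_n\}\in\mathcal{C}$ such that each $f_n$ is a stable degeneration of $g_n$ with respect to $\mathrm{SL}(m_n,\mathbb{F})$, $m_n$ the number of variables of $f_n$ and $g_n$. For $f=\sum_{\mathbf{e}}\alpha_{\mathbf{e}}\mathbf{x}^{\mathbf{e}}$, $\mathrm{NPT}(f)$ is the convex hull of the exponent vectors with nonzero coefficient; a face of a polytope $P$ is $P\cap\{v:\ell(v)=c\}$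 with $\ell$ linear and $\ell\ge c$ on $P$; $f|_Q=\sum_{\mathbf{e}\in Q}\alpha_{\mathbf{e}}\mathbf{x}^{\mathbf{e}}$. $\{f_n\}\in\mathrm{Newton}\text{-}\mathcal{C}$ if there is $\{g_n\}\in\mathcal{C}$ such that each $f_n$ is $g_n|_Q$ for a face $Q$ of $\mathrm{NPT}(g_n)$, or a linear projection of such a polynomial.
   Formalization: The general claim is stated for classes C closed under SL(m_n,F) changes of variables; for arbitrary C it fails, e.g. C = {constant family L1²L2L3} with generic binary linear forms, which has a stable degeneration p²q² outside Newton-C. VP and VNP need no extra assumption. *)

theory Defs
  imports
    "HOL-Computational_Algebra.Polynomial"
    "HOL-Library.Poly_Mapping"
    "HOL-Analysis.Convex"
    "HOL-Analysis.Finite_Function_Topology"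
    "Jordan_Normal_Form.Determinant"
    "Jordan_Normal_Form.Gauss_Jordan_Elimination"
begin

section \<open>Multivariate polynomials\<close>

text \<open>
  A polynomial maps exponent vectors to coefficients. The variables of
  \<open>\<F>[x\<^sub>1, \<dots>, x\<^sub>m]\<close> are numbered \<open>0, \<dots>, m - 1\<close>.
\<close>

type_synonym ('v, 'a) mpoly = "('v \<Rightarrow>\<^sub>0 nat) \<Rightarrow>\<^sub>0 'a"

definition Const :: "'a::zero \<Rightarrow> ('v, 'a) mpoly" where
  "Const c = Poly_Mapping.single 0 c"

definition Var :: "'v \<Rightarrow> ('v, 'a::zero_neq_one) mpoly" where
  "Var v = Poly_Mapping.single (Poly_Mapping.single v 1) 1"

definition vars :: "('v, 'a::zero) mpoly \<Rightarrow> 'v set" where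
  "vars f = (\<Union>e\<in>Poly_Mapping.keys f. Poly_Mapping.keys e)"

definition total_degree :: "('v, 'a::zero) mpoly \<Rightarrow> nat" where
  "total_degree f = Max (insert 0
     ((\<lambda>e. \<Sum>v\<in>Poly_Mapping.keys e. Poly_Mapping.lookup e v) ` Poly_Mapping.keys f))"

definition polys :: "nat \<Rightarrow> (nat, 'a::zero) mpoly set" where
  "polys m = {f. vars f \<subseteq> {..<m}}"

text \<open>Evaluation, with the coefficients transported along \<open>\<phi>\<close>.\<close>

definition eval_mpoly :: "('a::zero \<Rightarrow> 'b) \<Rightarrow> ('v \<Rightarrow> 'b) \<Rightarrow> ('v, 'a) mpoly \<Rightarrow> 'b::comm_semiring_1" where
  "eval_mpoly \<phi> s f = (\<Sum>e\<in>Poly_Mapping.keys f. \<phi> (Poly_Mapping.lookup f e) *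
     (\<Prod>v\<in>Poly_Mapping.keys e. s v ^ Poly_Mapping.lookup e v))"

definition subst :: "('v \<Rightarrow> ('w, 'a) mpoly) \<Rightarrow> ('v, 'a) mpoly \<Rightarrow> ('w, 'a::comm_semiring_1) mpoly" where
  "subst s f = eval_mpoly Const s f"

section \<open>Families\<close>

text \<open>
  A family records the number \<open>m\<^sub>n\<close> of variables together with \<open>f\<^sub>n \<in> \<F>[x\<^sub>1, \<dots>, x\<^sub>m\<^sub>n]\<close>;
  not all \<open>m\<^sub>n\<close> variables need to occur in \<open>f\<^sub>n\<close>.
\<close>

type_synonym 'a family = "nat \<Rightarrow> nat \<times> (nat, 'a) mpoly"

abbreviation nvars :: "'a family \<Rightarrow> nat \<Rightarrow> nat" where
  "nvars f n \<equiv> fst (f n)"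

abbreviation member :: "'a family \<Rightarrow> nat \<Rightarrow> (nat, 'a) mpoly" where
  "member f n \<equiv> snd (f n)"

definition poly_bounded :: "(nat \<Rightarrow> nat) \<Rightarrow> bool" where
  "poly_bounded t \<longleftrightarrow> (\<exists>p :: nat poly. \<forall>n. t n \<le> poly p n)"

definition p_bounded :: "'a::zero family \<Rightarrow> bool" where
  "p_bounded f \<longleftrightarrow> (\<forall>n. member f n \<in> polys (nvars f n)) \<and>
     poly_bounded (nvars f) \<and> poly_bounded (\<lambda>n. total_degree (member f n))"

definition affine_forms :: "nat \<Rightarrow> (nat, 'a::comm_ring_1) mpoly set" where
  "affine_forms k = {Const b + (\<Sum>j<k. Const (a j) * Var j) | a b. True}"

text \<open>\<open>f\<close>, in \<open>k\<close> new variables, is a linear projection of \<open>g \<in> \<F>[x\<^sub>1, \<dots>, x\<^sub>m]\<close>.\<close>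

definition linear_projection ::
    "nat \<Rightarrow> (nat, 'a) mpoly \<Rightarrow> nat \<Rightarrow> (nat, 'a::comm_ring_1) mpoly \<Rightarrow> bool" where
  "linear_projection k f m g \<longleftrightarrow>
     (\<exists>s. (\<forall>i<m. s i \<in> affine_forms k) \<and> f = subst s g)"

section \<open>Stable degenerations\<close>

definition SL :: "nat \<Rightarrow> 'a::field mat set" where
  "SL m = {\<sigma> \<in> carrier_mat m m. det \<sigma> = 1}"

definition SL_act :: "nat \<Rightarrow> 'a mat \<Rightarrow> (nat, 'a) mpoly \<Rightarrow> (nat, 'a::field) mpoly" where
  "SL_act m \<sigma> f =
     subst (\<lambda>i. \<Sum>j<m. Const (the (mat_inverse \<sigma>) $$ (i, j)) * Var j) f"

definition SL_orbit :: "nat \<Rightarrow> (nat, 'a) mpoly \<Rightarrow> (nat, 'a::field) mpoly set" where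
  "SL_orbit m f = (\<lambda>\<sigma>. SL_act m \<sigma> f) ` SL m"

text \<open>
  The Zariski closed subsets of \<open>\<F>[x\<^sub>1, \<dots>, x\<^sub>m]\<close> are the common zero sets of
  polynomials \<open>\<Phi>\<close> in the coefficients; the variables of \<open>\<Phi>\<close> are indexed by exponent vectors.
  On the space of polynomials of degree at most \<open>d\<close>, which is itself closed, this induces
  the usual Zariski topology of a finite-dimensional vector space.
\<close>

definition zariski_closed :: "nat \<Rightarrow> (nat, 'a::field) mpoly set \<Rightarrow> bool" where
  "zariski_closed m S \<longleftrightarrow> (\<exists>P :: (nat \<Rightarrow>\<^sub>0 nat, 'a) mpoly set.
     S = {f \<in> polys m. \<forall>\<Phi>\<in>P. eval_mpoly (\<lambda>c. c) (Poly_Mapping.lookup f) \<Phi> = 0})"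

definition zariski_closure :: "nat \<Rightarrow> (nat, 'a) mpoly set \<Rightarrow> (nat, 'a::field) mpoly set" where
  "zariski_closure m S = zariski_closed m hull S"

text \<open>
  Since the closure of the orbit of \<open>g\<close> contains exactly one closed orbit, the set \<open>T\<close>
  below is that orbit.
\<close>

definition stable_degeneration :: "nat \<Rightarrow> (nat, 'a) mpoly \<Rightarrow> (nat, 'a::field) mpoly \<Rightarrow> bool" where
  "stable_degeneration m f g \<longleftrightarrow>
     (\<exists>T. (\<exists>h\<in>polys m. T = SL_orbit m h) \<and> zariski_closed m T \<and>
          T \<subseteq> zariski_closure m (SL_orbit m g) \<and> f \<in> T)"

definition Stable :: "'a family set \<Rightarrow> 'a::field family set" where
  "Stable C = {f. f \<in> C \<or> (\<exists>g\<in>C. \<forall>n. nvars f n = nvars g n \<and>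
     stable_degeneration (nvars f n) (member f n) (member g n))}"

text \<open>
  Closure of a class under unimodular linear changes of coordinates. Every class closed
  under linear projections has this property.
\<close>

definition SL_invariant :: "'a::field family set \<Rightarrow> bool" where
  "SL_invariant C \<longleftrightarrow> (\<forall>g\<in>C. \<forall>\<sigma>. (\<forall>n. \<sigma> n \<in> SL (nvars g n)) \<longrightarrow>
     (\<lambda>n. (nvars g n, SL_act (nvars g n) (\<sigma> n) (member g n))) \<in> C)"

section \<open>Newton degenerations\<close>

text \<open>
  All Newton polytopes live in the real vector space of finitely supported sequences,
  which contains every \<open>\<real>\<^sup>m\<close>; linear functionals on \<open>\<real>\<^sup>m\<close> are the restrictions of
  linear functionals on it.
\<close>

definition exponent_vector :: "(nat \<Rightarrow>\<^sub>0 nat) \<Rightarrow> (nat \<Rightarrow>\<^sub>0 real)" where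
  "exponent_vector e = Poly_Mapping.map real e"

definition NPT :: "(nat, 'a::zero) mpoly \<Rightarrow> (nat \<Rightarrow>\<^sub>0 real) set" where
  "NPT f = convex hull (exponent_vector ` Poly_Mapping.keys f)"

definition faces :: "'v::real_vector set \<Rightarrow> 'v set set" where
  "faces P = {P \<inter> {v. l v = c} | (l :: 'v \<Rightarrow> real) c. linear l \<and> (\<forall>v\<in>P. l v \<ge> c)}"

definition restrict_to :: "(nat, 'a) mpoly \<Rightarrow> (nat \<Rightarrow>\<^sub>0 real) set \<Rightarrow> (nat, 'a::comm_monoid_add) mpoly" where
  "restrict_to f Q = (\<Sum>e | e \<in> Poly_Mapping.keys f \<and> exponent_vector e \<in> Q.
     Poly_Mapping.single e (Poly_Mapping.lookup f e))"

text \<open>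
  Only p-bounded families are admitted; the number of new variables of a linear projection
  would otherwise be unrestricted.
\<close>

definition Newton :: "'a family set \<Rightarrow> 'a::comm_ring_1 family set" where
  "Newton C = {f. p_bounded f \<and> (\<exists>g\<in>C. \<forall>n. \<exists>Q\<in>faces (NPT (member g n)).
     (nvars f n = nvars g n \<and> member f n = restrict_to (member g n) Q) \<or>
     linear_projection (nvars f n) (member f n) (nvars g n) (restrict_to (member g n) Q))}"

section \<open>VP and VNP\<close>

text \<open>
  A circuit is the list of its gates in topological order: the operands of the gate at
  position \<open>i\<close> are positions smaller than \<open>i\<close>, and the output is the last gate. The size
  is the number of gates.
\<close>

datatype 'a gate = Input nat | Scalar 'a | Add nat nat | Mult nat nat

fun wf_gate :: "nat \<Rightarrow> nat \<Rightarrow> 'a gate \<Rightarrow> bool" where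
  "wf_gate m i (Input v) \<longleftrightarrow> v < m"
| "wf_gate m i (Scalar c) \<longleftrightarrow> True"
| "wf_gate m i (Add j k) \<longleftrightarrow> j < i \<and> k < i"
| "wf_gate m i (Mult j k) \<longleftrightarrow> j < i \<and> k < i"

definition wf_circuit :: "nat \<Rightarrow> 'a gate list \<Rightarrow> bool" where
  "wf_circuit m c \<longleftrightarrow> c \<noteq> [] \<and> (\<forall>i<length c. wf_gate m i (c ! i))"

fun gate_val :: "(nat, 'a) mpoly list \<Rightarrow> 'a gate \<Rightarrow> (nat, 'a::comm_ring_1) mpoly" where
  "gate_val vs (Input v) = Var v"
| "gate_val vs (Scalar c) = Const c"
| "gate_val vs (Add j k) = vs ! j + vs ! k"
| "gate_val vs (Mult j k) = vs ! j * vs ! k"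

definition circuit_val :: "'a gate list \<Rightarrow> (nat, 'a::comm_ring_1) mpoly" where
  "circuit_val c = last (foldl (\<lambda>vs g. vs @ [gate_val vs g]) [] c)"

definition VP :: "'a::comm_ring_1 family set" where
  "VP = {f. p_bounded f \<and> (\<exists>c. poly_bounded (\<lambda>n. length (c n)) \<and>
     (\<forall>n. wf_circuit (nvars f n) (c n) \<and> circuit_val (c n) = member f n))}"

text \<open>
  \<open>f\<^sub>n(x) = \<Sum>\<^sub>w g\<^sub>n(x, w)\<close>, where \<open>w\<close> runs over the \<open>0\<close>-\<open>1\<close> assignments to the
  variables of \<open>g\<^sub>n\<close> beyond those of \<open>f\<^sub>n\<close>.
\<close>

definition VNP :: "'a::comm_ring_1 family set" where
  "VNP = {f. p_bounded f \<and> (\<exists>g\<in>VP. \<forall>n. nvars f n \<le> nvars g n \<and>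
     member f n = (\<Sum>w \<in> {nvars f n..<nvars g n} \<rightarrow>\<^sub>E {0, 1}.
       subst (\<lambda>i. if i < nvars f n then Var i else Const (w i)) (member g n)))}"

end

theory Submission
  imports Defs "HOL-Computational_Algebra.Fraction_Field"
begin

text \<open>
  Hilbert--Mumford by places. Let \<open>f\<close> lie in a closed orbit \<open>T\<close> contained in the closure of
  \<open>SL\<^sub>m \<cdot> g\<close>, and let \<open>X\<close> be a generic matrix of determinant one over the function field \<open>K\<close>.
  Evaluation of polynomials in the coefficients of \<open>X \<cdot> g\<close> at those of \<open>f\<close> is a well defined
  homomorphism into the algebraically closed field \<open>\<F>\<close>, and so extends to a place of \<open>K\<close>.
  Over its valuation ring \<open>X = A D B\<close> with \<open>A\<close>, \<open>B\<close> integral of determinant one and \<open>D\<close> a point of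
  the torus over \<open>K\<close>. For the translate \<open>g'\<close> of \<open>g\<close> under the residue of \<open>A\<close> and a suitable
  translate \<open>c \<in> T\<close> of \<open>f\<close>, the place takes the translate of \<open>g\<close> under \<open>A\<close> to \<open>g'\<close>, and the further
  translate by \<open>D\<close> to \<open>c\<close>.
  A real functional \<open>w\<close> with the signs of the valuations of the monomials of \<open>g'\<close> in \<open>D\<close> is
  nonnegative on the Newton polytope of \<open>g'\<close>, and the translate of \<open>c\<close> by the inverse of \<open>D\<close> specializes to the
  restriction of \<open>g'\<close> to the face \<open>w = 0\<close>. As \<open>T\<close> is closed and stable, this restriction is in \<open>T\<close>;
  so \<open>f\<close> is one of its linear projections.
\<close>

section \<open>Evaluation and substitution\<close>

text \<open>A curve through the orbit with limit \<open>f\<close> would give a discrete valuation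
  and integral weights, but such a curve must first be found; a place extending the evaluation
  exists by Zorn's lemma. The price is a value group of unknown rank, in which \<open>D\<close>
  determines no one-parameter subgroup. Only the finitely many monomials of \<open>g'\<close> have
  to be compared, however, and on finitely many lattice vectors a total preorder is given by a real
  functional. The inverse of \<open>D\<close> is applied to \<open>c\<close> because poles and zeros
  are separated: \<open>g'\<close> has no monomial at which \<open>D\<close> has a pole, and
  \<open>c\<close> has none at which \<open>D\<close> has a zero. Undoing \<open>D\<close> thus
  keeps only the part on which it is a unit. \<open>T\<close> is stable under matrices over the
  ground field only, while \<open>D\<close> has entries in \<open>K\<close>; density of the
  constants among the points of the torus bridges this gap. The face belongs to the polytope of the
  translate \<open>g'\<close> rather than of \<open>g\<close>, which is what
  \<open>SL_invariant\<close> is for.\<close>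

abbreviation lookup where "lookup \<equiv> Poly_Mapping.lookup"
abbreviation keys where "keys \<equiv> Poly_Mapping.keys"
abbreviation single where "single \<equiv> Poly_Mapping.single"

lemma poly_mapping_decompose: "f = (\<Sum>e\<in>keys f. single e (lookup f e))"
  by (rule poly_mapping_eqI)
     (auto simp: lookup_sum lookup_single when_def sum.delta' in_keys_iff)

lemma poly_mapping_induct_add [case_names zero add single]:
  assumes "P 0" "\<And>f g. P f \<Longrightarrow> P g \<Longrightarrow> P (f + g)" "\<And>e c. P (single e c)"
  shows "P (f :: 'x \<Rightarrow>\<^sub>0 'y::comm_monoid_add)"
proof -
  have "P (\<Sum>e\<in>A. single e (lookup f e))" if "finite A" for A
    using that by (induction A rule: finite_induct) (auto intro: assms)
  from this[of "keys f"] show ?thesis by (simp flip: poly_mapping_decompose)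
qed

definition eval_monomial :: "('v \<Rightarrow> 'b) \<Rightarrow> ('v \<Rightarrow>\<^sub>0 nat) \<Rightarrow> 'b::comm_semiring_1" where
  "eval_monomial s e = (\<Prod>v\<in>keys e. s v ^ lookup e v)"

lemma eval_monomial_superset:
  assumes "finite V" "keys e \<subseteq> V"
  shows "eval_monomial s e = (\<Prod>v\<in>V. s v ^ lookup e v)"
  unfolding eval_monomial_def
  by (rule prod.mono_neutral_left) (use assms in \<open>auto simp: in_keys_iff\<close>)

lemma eval_monomial_0 [simp]: "eval_monomial s 0 = 1"
  by (simp add: eval_monomial_def)

lemma eval_monomial_add: "eval_monomial s (e + e') = eval_monomial s e * eval_monomial s e'"
proof -
  let ?V = "keys e \<union> keys e'"
  have "keys (e + e') \<subseteq> ?V" by (rule Poly_Mapping.keys_add)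
  then show ?thesis
    by (simp add: eval_monomial_superset[of ?V] lookup_add power_add prod.distrib)
qed

lemma eval_monomial_single [simp]: "eval_monomial s (single v n) = s v ^ n"
  by (cases "n = 0") (simp_all add: eval_monomial_def)

lemma eval_monomial_mult: "eval_monomial (\<lambda>v. s v * t v) e = eval_monomial s e * eval_monomial t e"
  by (simp add: eval_monomial_def power_mult_distrib prod.distrib)

lemma (in comm_ring_hom) hom_eval_monomial: "hom (eval_monomial s e) = eval_monomial (\<lambda>v. hom (s v)) e"
  by (simp add: eval_monomial_def hom_prod hom_power)

lemma eval_mpoly_superset:
  assumes "finite S" "keys f \<subseteq> S" "\<phi> 0 = 0"
  shows "eval_mpoly \<phi> s f = (\<Sum>e\<in>S. \<phi> (lookup f e) * eval_monomial s e)"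
  unfolding eval_mpoly_def eval_monomial_def
  by (rule sum.mono_neutral_left) (use assms in \<open>auto simp: in_keys_iff\<close>)

lemma eval_mpoly_cong:
  assumes "\<And>v. v \<in> vars f \<Longrightarrow> s v = t v"
  shows "eval_mpoly \<phi> s f = eval_mpoly \<phi> t f"
  unfolding eval_mpoly_def
  by (intro sum.cong prod.cong arg_cong2[of _ _ _ _ "(*)"] refl)
     (use assms in \<open>auto simp: vars_def intro!: arg_cong[of _ _ "\<lambda>x. x ^ _"]\<close>)

context comm_ring_hom
begin

lemma eval_mpoly_single [simp]: "eval_mpoly hom s (single e c) = hom c * eval_monomial s e"
  by (cases "c = 0") (simp_all add: eval_mpoly_def eval_monomial_def)

lemma eval_mpoly_add: "eval_mpoly hom s (f + g) = eval_mpoly hom s f + eval_mpoly hom s g"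
proof -
  let ?S = "keys f \<union> keys g"
  have "keys (f + g) \<subseteq> ?S" by (rule Poly_Mapping.keys_add)
  then show ?thesis
    by (simp add: eval_mpoly_superset[of ?S] lookup_add hom_add distrib_right sum.distrib)
qed

lemma eval_mpoly_mult: "eval_mpoly hom s (f * g) = eval_mpoly hom s f * eval_mpoly hom s g"
proof (induction f rule: poly_mapping_induct_add)
  case (single e c)
  show ?case
  proof (induction g rule: poly_mapping_induct_add)
    case (single e' c')
    show ?case by (simp add: mult_single eval_monomial_add hom_mult mult_ac)
  qed (simp_all add: eval_mpoly_add distrib_left eval_mpoly_def[of _ _ 0])
qed (simp_all add: eval_mpoly_add distrib_right eval_mpoly_def[of _ _ 0])

lemma eval_mpoly_one [simp]: "eval_mpoly hom s 1 = 1"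
  using eval_mpoly_single[of s 0 1] by simp

lemma comm_ring_hom_eval_mpoly: "comm_ring_hom (eval_mpoly hom s)"
  by unfold_locales (simp_all add: eval_mpoly_add eval_mpoly_mult eval_mpoly_def[of _ _ 0])

lemma eval_mpoly_Const [simp]: "eval_mpoly hom s (Const c) = hom c"
  by (simp add: Const_def)

lemma eval_mpoly_Var [simp]: "eval_mpoly hom s (Var v) = s v"
  by (simp add: Var_def)

end

lemma comm_ring_hom_Const: "comm_ring_hom (Const :: 'a::comm_ring_1 \<Rightarrow> ('v, 'a) mpoly)"
  by unfold_locales (simp_all add: Const_def single_add mult_single)

interpretation Const_hom: comm_ring_hom "Const :: 'a::comm_ring_1 \<Rightarrow> ('v, 'a) mpoly"
  by (rule comm_ring_hom_Const)

lemma comm_ring_hom_id: "comm_ring_hom (\<lambda>c::'a::comm_ring_1. c)"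
  by unfold_locales simp_all

lemma comm_ring_hom_subst: "comm_ring_hom (subst s :: ('v, 'a::comm_ring_1) mpoly \<Rightarrow> _)"
  using Const_hom.comm_ring_hom_eval_mpoly unfolding subst_def[abs_def] .

interpretation subst_hom: comm_ring_hom "subst s :: ('v, 'a::comm_ring_1) mpoly \<Rightarrow> ('w, 'a) mpoly"
  by (rule comm_ring_hom_subst)

lemma subst_Const [simp]: "subst s (Const (c::'a::comm_ring_1)) = Const c"
  and subst_Var [simp]: "subst s (Var v :: ('v, 'a) mpoly) = s v"
  by (simp_all add: subst_def)

lemma subst_single: "subst s (single e (c::'a::comm_ring_1)) = Const c * eval_monomial s e"
  by (simp add: subst_def)

lemma subst_cong:
  "(\<And>v. v \<in> vars f \<Longrightarrow> s v = t v) \<Longrightarrow> subst s f = subst t (f :: ('v, 'a::comm_ring_1) mpoly)"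
  unfolding subst_def by (rule eval_mpoly_cong)

lemma (in comm_ring_hom) eval_mpoly_subst:
  "eval_mpoly hom s (subst t f) = eval_mpoly hom (\<lambda>v. eval_mpoly hom s (t v)) f"
proof (induction f rule: poly_mapping_induct_add)
  case (single e c)
  interpret ev: comm_ring_hom "eval_mpoly hom s" by (rule comm_ring_hom_eval_mpoly)
  show ?case
    by (simp add: subst_single ev.hom_eval_monomial eval_mpoly_mult)
qed (simp_all add: eval_mpoly_add subst_hom.hom_add eval_mpoly_def[of _ _ 0])

lemma subst_subst: "subst s (subst t f) = subst (\<lambda>v. subst s (t v)) (f :: ('v, 'a::comm_ring_1) mpoly)"
  unfolding subst_def[of s] by (subst Const_hom.eval_mpoly_subst) (simp add: subst_def)

lemma eval_monomial_Var: "eval_monomial Var e = (single e 1 :: ('v, 'a::comm_ring_1) mpoly)"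
proof (induction e rule: poly_mapping_induct_add)
  case (single v n)
  have "Var v ^ n = (single (single v n) 1 :: ('v, 'a) mpoly)"
  proof (induction n)
    case (Suc n)
    have "single v (Suc n) = single v (1::nat) + single v n"
      by (simp flip: single_add)
    with Suc show ?case by (simp add: Var_def mult_single)
  qed simp
  then show ?case by simp
qed (simp_all add: eval_monomial_add mult_single)

lemma subst_Var_id: "subst Var f = (f :: ('v, 'a::comm_ring_1) mpoly)"
proof (induction f rule: poly_mapping_induct_add)
  case (single e c)
  show ?case by (simp add: subst_single eval_monomial_Var Const_def mult_single)
qed (simp_all add: subst_hom.hom_add)

lemma lookup_Const_mult [simp]: "lookup (Const c * f) e = c * lookup f e" for c :: "'a::comm_ring_1"
proof (induction f rule: poly_mapping_induct_add)
  case (single e' c')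
  show ?case by (simp add: Const_def mult_single lookup_single when_def)
qed (simp_all add: distrib_left lookup_add)

lemma subst_scale_single:
  "subst (\<lambda>v. Const (\<chi> v) * Var v) (single e c) = single e (c * eval_monomial \<chi> e)"
  for c :: "'a::comm_ring_1"
  by (simp add: subst_single eval_monomial_mult eval_monomial_Var flip: Const_hom.hom_eval_monomial)
     (simp add: Const_def mult_single)

lemma lookup_subst_scale:
  "lookup (subst (\<lambda>v. Const (\<chi> v) * Var v) f) e = lookup f e * eval_monomial \<chi> e"
  for f :: "('v, 'a::comm_ring_1) mpoly"
  by (induction f rule: poly_mapping_induct_add)
     (simp_all add: subst_hom.hom_add lookup_add distrib_right subst_scale_single lookup_single when_def)

section \<open>Linear substitutions and orbits of the special linear group\<close>

lemma polysI: "(\<And>e. e \<in> keys f \<Longrightarrow> keys e \<subseteq> {..<m}) \<Longrightarrow> f \<in> polys m"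
  by (auto simp: polys_def vars_def)

lemma polysD: "f \<in> polys m \<Longrightarrow> e \<in> keys f \<Longrightarrow> keys e \<subseteq> {..<m}"
  by (auto simp: polys_def vars_def)

lemma Const_in_polys [simp]: "Const c \<in> polys m"
  by (auto simp: polys_def vars_def Const_def split: if_splits)

lemma Var_in_polys [simp]: "j < m \<Longrightarrow> Var j \<in> polys m"
  by (auto simp: polys_def vars_def Var_def split: if_splits)

lemma add_in_polys: "f \<in> polys m \<Longrightarrow> g \<in> polys m \<Longrightarrow> f + g \<in> polys m"
  using Poly_Mapping.keys_add[of f g] by (fastforce simp: polys_def vars_def)

lemma mult_in_polys:
  fixes f g :: "(nat, 'a::comm_ring_1) mpoly"
  assumes "f \<in> polys m" "g \<in> polys m"
  shows "f * g \<in> polys m"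
proof (rule polysI)
  fix e assume "e \<in> keys (f * g)"
  then obtain a b where "e = a + b" "a \<in> keys f" "b \<in> keys g"
    using keys_mult[of f g] by blast
  then show "keys e \<subseteq> {..<m}"
    using Poly_Mapping.keys_add[of a b] polysD[OF assms(1)] polysD[OF assms(2)] by blast
qed

lemma zero_in_polys [simp]: "0 \<in> polys m"
  by (simp add: polys_def vars_def)

lemma one_in_polys [simp]: "(1 :: (nat, 'a::comm_ring_1) mpoly) \<in> polys m"
  by (metis Const_in_polys Const_hom.hom_one)

lemma sum_in_polys: "(\<And>i. i \<in> I \<Longrightarrow> f i \<in> polys m) \<Longrightarrow> sum f I \<in> polys m"
  by (induction I rule: infinite_finite_induct) (auto intro: add_in_polys)

lemma power_in_polys: "f \<in> polys m \<Longrightarrow> f ^ n \<in> polys m" for f :: "(nat, 'a::comm_ring_1) mpoly"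
  by (induction n) (auto intro: mult_in_polys)

lemma prod_in_polys: "(\<And>i. i \<in> I \<Longrightarrow> f i \<in> polys m) \<Longrightarrow> prod f I \<in> polys m"
  for f :: "'i \<Rightarrow> (nat, 'a::comm_ring_1) mpoly"
  by (induction I rule: infinite_finite_induct) (auto intro: mult_in_polys)

lemma subst_in_polys:
  fixes f :: "('v, 'a::comm_ring_1) mpoly"
  assumes "\<And>v. v \<in> vars f \<Longrightarrow> s v \<in> polys m"
  shows "subst s f \<in> polys m"
  unfolding subst_def eval_mpoly_def
  by (intro sum_in_polys mult_in_polys prod_in_polys power_in_polys Const_in_polys assms)
     (auto simp: vars_def)

section \<open>Degrees under substitution\<close>

definition monomial_degree :: "('v \<Rightarrow>\<^sub>0 nat) \<Rightarrow> nat" where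
  "monomial_degree e = (\<Sum>v\<in>keys e. lookup e v)"

lemma monomial_degree_add: "monomial_degree (a + b) = monomial_degree a + monomial_degree b"
proof -
  have *: "monomial_degree e = (\<Sum>v\<in>keys a \<union> keys b. lookup e v)" if "keys e \<subseteq> keys a \<union> keys b" for e
    unfolding monomial_degree_def
    by (rule sum.mono_neutral_left) (use that in \<open>auto simp: in_keys_iff\<close>)
  show ?thesis
    using Poly_Mapping.keys_add[of a b] by (simp add: * lookup_add sum.distrib)
qed

lemma total_degree_le_iff: "total_degree f \<le> d \<longleftrightarrow> (\<forall>e\<in>keys f. monomial_degree e \<le> d)"
  unfolding total_degree_def monomial_degree_def by (subst Max_le_iff) auto

lemma monomial_degree_le_total_degree: "e \<in> keys f \<Longrightarrow> monomial_degree e \<le> total_degree f"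
  using total_degree_le_iff by blast

lemma total_degree_add_le:
  "total_degree f \<le> d \<Longrightarrow> total_degree g \<le> d \<Longrightarrow> total_degree (f + g) \<le> d"
  using Poly_Mapping.keys_add[of f g] by (auto simp: total_degree_le_iff)

lemma total_degree_mult_le:
  fixes f g :: "('v, 'a::comm_ring_1) mpoly"
  assumes "total_degree f \<le> c" "total_degree g \<le> d"
  shows "total_degree (f * g) \<le> c + d"
  unfolding total_degree_le_iff
proof
  fix e assume "e \<in> keys (f * g)"
  then obtain a b where "e = a + b" "a \<in> keys f" "b \<in> keys g"
    using keys_mult[of f g] by blast
  then show "monomial_degree e \<le> c + d"
    using assms by (auto simp: monomial_degree_add total_degree_le_iff intro!: add_mono)
qed

lemma total_degree_Const [simp]: "total_degree (Const c) = 0"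
  using total_degree_le_iff[of "Const c" 0]
  by (auto simp: Const_def monomial_degree_def split: if_splits)

lemma total_degree_Var_le: "total_degree (Var v) \<le> 1"
  by (auto simp: total_degree_le_iff Var_def monomial_degree_def split: if_splits)

lemma total_degree_one [simp]: "total_degree (1 :: ('v, 'a::comm_ring_1) mpoly) = 0"
  by (metis total_degree_Const Const_hom.hom_one)

lemma total_degree_zero [simp]: "total_degree 0 = 0"
  using total_degree_le_iff[of 0 0] by auto

lemma total_degree_sum_le: "(\<And>i. i \<in> I \<Longrightarrow> total_degree (f i) \<le> d) \<Longrightarrow> total_degree (sum f I) \<le> d"
  by (induction I rule: infinite_finite_induct) (auto intro: total_degree_add_le)

lemma total_degree_power_le:
  "total_degree f \<le> d \<Longrightarrow> total_degree (f ^ n) \<le> d * n" for f :: "('v, 'a::comm_ring_1) mpoly"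
  by (induction n) (auto intro: total_degree_mult_le)

lemma total_degree_prod_le:
  fixes f :: "'i \<Rightarrow> ('v, 'a::comm_ring_1) mpoly"
  shows "(\<And>i. i \<in> I \<Longrightarrow> total_degree (f i) \<le> d i) \<Longrightarrow> total_degree (prod f I) \<le> sum d I"
  by (induction I rule: infinite_finite_induct) (auto intro: total_degree_mult_le)

lemma total_degree_subst_le:
  fixes f :: "('v, 'a::comm_ring_1) mpoly"
  assumes "\<And>v. total_degree (s v) \<le> 1"
  shows "total_degree (subst s f) \<le> total_degree f"
  unfolding subst_def eval_mpoly_def
proof (rule total_degree_sum_le)
  fix e assume e: "e \<in> keys f"
  have "total_degree (\<Prod>v\<in>keys e. s v ^ lookup e v) \<le> monomial_degree e"
    unfolding monomial_degree_def
  proof (rule total_degree_prod_le)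
    show "total_degree (s v ^ lookup e v) \<le> lookup e v" for v
      using total_degree_power_le[OF assms, of v "lookup e v"] by simp
  qed
  also have "\<dots> \<le> total_degree f" using e by (rule monomial_degree_le_total_degree)
  finally have "total_degree (\<Prod>v\<in>keys e. s v ^ lookup e v) \<le> total_degree f" .
  from total_degree_mult_le[OF order.refl this]
  show "total_degree (Const (lookup f e) * (\<Prod>v\<in>keys e. s v ^ lookup e v)) \<le> total_degree f"
    by (metis add_0 total_degree_Const)
qed

section \<open>Matrices acting by linear substitution\<close>

definition linear_form :: "nat \<Rightarrow> 'a mat \<Rightarrow> nat \<Rightarrow> (nat, 'a::comm_ring_1) mpoly" where
  "linear_form m M i = (\<Sum>j<m. Const (M $$ (i, j)) * Var j)"

text \<open>Unlike in \<open>SL_act\<close>, no inverse is taken, so that every square matrix over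
  any commutative ring acts: matrices over the function field, their residues, and the arbitrary
  ones in the circuit bounds.\<close>

definition act :: "nat \<Rightarrow> 'a mat \<Rightarrow> (nat, 'a) mpoly \<Rightarrow> (nat, 'a::comm_ring_1) mpoly" where
  "act m M = subst (linear_form m M)"

lemma linear_form_in_polys: "linear_form m M i \<in> polys m"
  unfolding linear_form_def by (intro sum_in_polys mult_in_polys Const_in_polys Var_in_polys) auto

lemma act_in_polys: "act m M f \<in> polys m"
  unfolding act_def by (rule subst_in_polys) (rule linear_form_in_polys)

lemma total_degree_linear_form_le: "total_degree (linear_form m M i) \<le> 1"
  unfolding linear_form_def
proof (rule total_degree_sum_le)
  show "total_degree (Const (M $$ (i, j)) * Var j) \<le> 1" for j :: nat
    using total_degree_mult_le[OF _ total_degree_Var_le, of "Const (M $$ (i, j))" 0 j] by simp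
qed

lemma total_degree_act_le: "total_degree (act m M f) \<le> total_degree f"
  unfolding act_def by (rule total_degree_subst_le) (rule total_degree_linear_form_le)

lemma act_linear_form:
  assumes "M \<in> carrier_mat m m" "N \<in> carrier_mat m m" "i < m"
  shows "act m N (linear_form m M i) = linear_form m (M * N) i"
proof -
  have "act m N (linear_form m M i) = (\<Sum>j<m. \<Sum>k<m. Const (M $$ (i, j) * N $$ (j, k)) * Var k)"
    unfolding linear_form_def act_def
    by (simp add: subst_hom.hom_sum subst_hom.hom_mult linear_form_def sum_distrib_left mult.assoc Const_hom.hom_mult)
  also have "\<dots> = (\<Sum>k<m. Const (\<Sum>j<m. M $$ (i, j) * N $$ (j, k)) * Var k)"
    by (subst sum.swap) (simp add: Const_hom.hom_sum sum_distrib_right)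
  also have "\<dots> = linear_form m (M * N) i"
    unfolding linear_form_def using assms
    by (intro sum.cong refl arg_cong2[of _ _ _ _ "(*)"] arg_cong[of _ _ Const])
       (auto simp: scalar_prod_def lessThan_atLeast0)
  finally show ?thesis .
qed

lemma subst_cong_polys:
  "f \<in> polys m \<Longrightarrow> (\<And>i. i < m \<Longrightarrow> s i = t i) \<Longrightarrow> subst s f = subst t (f :: (nat, 'a::comm_ring_1) mpoly)"
  by (rule subst_cong) (auto simp: polys_def)

text \<open>Substitution composes in reverse order, so \<open>act\<close> is a right action. Acting
  by a product \<open>A * D * B\<close> therefore applies \<open>A\<close> first, then
  \<open>D\<close>, then \<open>B\<close>.\<close>

lemma act_act:
  assumes "M \<in> carrier_mat m m" "N \<in> carrier_mat m m" "f \<in> polys m"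
  shows "act m N (act m M f) = act m (M * N) f"
  using act_linear_form[OF assms(1,2)] assms(3) unfolding act_def
  by (simp add: subst_subst cong: subst_cong_polys)

lemma linear_form_diagonal:
  assumes "\<And>j. j < m \<Longrightarrow> D $$ (i, j) = (if i = j then d i else 0)" "i < m"
  shows "linear_form m D i = Const (d i) * Var i"
proof -
  have "linear_form m D i = (\<Sum>j<m. if j = i then Const (d i) * Var i else 0)"
    unfolding linear_form_def by (intro sum.cong) (use assms in auto)
  with assms(2) show ?thesis by simp
qed

lemma lookup_act_diagonal:
  assumes "f \<in> polys m" "\<And>i j. i < m \<Longrightarrow> j < m \<Longrightarrow> D $$ (i, j) = (if i = j then d i else 0)"
  shows "lookup (act m D f) e = lookup f e * eval_monomial d e"
proof -
  have "act m D f = subst (\<lambda>i. Const (d i) * Var i) f"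
    unfolding act_def using assms by (intro subst_cong_polys linear_form_diagonal)
  then show ?thesis by (simp add: lookup_subst_scale)
qed

lemma SL_act_eq: "SL_act m \<sigma> f = act m (the (mat_inverse \<sigma>)) f"
  by (simp add: SL_act_def act_def linear_form_def[abs_def])

lemma SL_mult: "M \<in> SL m \<Longrightarrow> N \<in> SL m \<Longrightarrow> M * N \<in> SL m"
  by (auto simp: SL_def det_mult)

lemma SL_mat_inverse:
  fixes \<sigma> :: "'a::field mat"
  assumes "\<sigma> \<in> SL m"
  shows "the (mat_inverse \<sigma>) \<in> SL m" "\<sigma> * the (mat_inverse \<sigma>) = 1\<^sub>m m" "the (mat_inverse \<sigma>) * \<sigma> = 1\<^sub>m m"
proof -
  from assms have \<sigma>: "\<sigma> \<in> carrier_mat m m" "det \<sigma> = 1" by (auto simp: SL_def)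
  then have "\<sigma> \<in> Units (ring_mat TYPE('a) m ())" using det_non_zero_imp_unit[OF \<sigma>(1)] by simp
  with mat_inverse(1)[OF \<sigma>(1), where b = "()"] obtain \<tau> where \<tau>: "mat_inverse \<sigma> = Some \<tau>" by blast
  from mat_inverse(2)[OF \<sigma>(1) this]
  have inv: "\<sigma> * \<tau> = 1\<^sub>m m" "\<tau> * \<sigma> = 1\<^sub>m m" "\<tau> \<in> carrier_mat m m" by auto
  then have "det \<tau> = 1" using det_mult[OF \<sigma>(1) inv(3)] \<sigma>(2) by simp
  with inv \<tau> show "the (mat_inverse \<sigma>) \<in> SL m" "\<sigma> * the (mat_inverse \<sigma>) = 1\<^sub>m m"
    "the (mat_inverse \<sigma>) * \<sigma> = 1\<^sub>m m" by (auto simp: SL_def)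
qed

lemma SL_mat_inverse_mat_inverse:
  assumes "\<sigma> \<in> SL m"
  shows "the (mat_inverse (the (mat_inverse \<sigma>))) = \<sigma>"
proof -
  let ?\<tau> = "the (mat_inverse \<sigma>)"
  have \<tau>: "?\<tau> \<in> SL m" by (rule SL_mat_inverse[OF assms])
  have c: "\<sigma> \<in> carrier_mat m m" "?\<tau> \<in> carrier_mat m m" "the (mat_inverse ?\<tau>) \<in> carrier_mat m m"
    using assms \<tau> SL_mat_inverse(1)[OF \<tau>] by (auto simp: SL_def)
  have "the (mat_inverse ?\<tau>) = (\<sigma> * ?\<tau>) * the (mat_inverse ?\<tau>)"
    using SL_mat_inverse[OF assms] c by simp
  also have "\<dots> = \<sigma> * (?\<tau> * the (mat_inverse ?\<tau>))" using c by (simp add: assoc_mult_mat[of _ m m _ m _ m])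
  also have "\<dots> = \<sigma>" using SL_mat_inverse[OF \<tau>] c by simp
  finally show ?thesis .
qed

text \<open>Inversion permutes \<open>SL m\<close>, so the left action by inverses and the right
  action \<open>act\<close> have the same orbits.\<close>

lemma SL_orbit_eq: "SL_orbit m h = (\<lambda>M. act m M h) ` SL m"
proof
  show "SL_orbit m h \<subseteq> (\<lambda>M. act m M h) ` SL m"
    by (auto simp: SL_orbit_def SL_act_eq intro: SL_mat_inverse)
  show "(\<lambda>M. act m M h) ` SL m \<subseteq> SL_orbit m h"
  proof
    fix f assume "f \<in> (\<lambda>M. act m M h) ` SL m"
    then obtain M where M: "M \<in> SL m" "f = act m M h" by auto
    then have "f = SL_act m (the (mat_inverse M)) h" by (simp add: SL_act_eq SL_mat_inverse_mat_inverse)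
    with SL_mat_inverse(1)[OF M(1)] show "f \<in> SL_orbit m h" by (auto simp: SL_orbit_def)
  qed
qed

lemma act_in_SL_orbit:
  assumes "h \<in> polys m" "f \<in> SL_orbit m h" "M \<in> SL m"
  shows "act m M f \<in> SL_orbit m h"
proof -
  from assms(2) obtain N where N: "N \<in> SL m" "f = act m N h" by (auto simp: SL_orbit_eq)
  have "act m M f = act m (N * M) h"
    using N assms by (simp add: act_act SL_def)
  with SL_mult[OF N(1) assms(3)] show ?thesis by (auto simp: SL_orbit_eq)
qed

lemma SL_orbit_subset_polys: "SL_orbit m h \<subseteq> polys m"
  by (auto simp: SL_orbit_eq act_in_polys)

lemma SL_orbit_connected:
  assumes h: "h \<in> polys m" and "f \<in> SL_orbit m h" "g \<in> SL_orbit m h"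
  obtains M where "M \<in> SL m" "f = act m M g"
proof -
  from assms obtain A B where AB: "A \<in> SL m" "f = act m A h" "B \<in> SL m" "g = act m B h"
    by (auto simp: SL_orbit_eq)
  let ?B = "the (mat_inverse B)"
  have B: "?B \<in> SL m" "B * ?B = 1\<^sub>m m" using SL_mat_inverse[OF AB(3)] by auto
  have "act m (?B * A) g = act m (B * (?B * A)) h"
    unfolding AB(4) by (rule act_act) (use AB B h in \<open>auto simp: SL_def\<close>)
  also have "B * (?B * A) = A"
    using B AB left_mult_one_mat[of A m m] by (simp add: SL_def flip: assoc_mult_mat[of B m m ?B m A m])
  finally show thesis using AB B by (intro that[of "?B * A"]) (auto intro: SL_mult)
qed

section \<open>Extension of places\<close>

text \<open>A partial homomorphism from \<open>'k\<close> to \<open>'a\<close> is represented by its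
  graph, a subring of the product ring. Ring expressions in related arguments are then related, and
  neither a domain nor values have to be named.\<close>

locale ring_rel =
  fixes R :: "('k::comm_ring_1 \<times> 'a::comm_ring_1) set"
  assumes rel_one: "(1, 1) \<in> R"
    and rel_add: "(x, a) \<in> R \<Longrightarrow> (y, b) \<in> R \<Longrightarrow> (x + y, a + b) \<in> R"
    and rel_mult: "(x, a) \<in> R \<Longrightarrow> (y, b) \<in> R \<Longrightarrow> (x * y, a * b) \<in> R"
    and rel_uminus: "(x, a) \<in> R \<Longrightarrow> (- x, - a) \<in> R"
begin

lemma rel_zero: "(0, 0) \<in> R"
  using rel_add[OF rel_one rel_uminus[OF rel_one]] by simp

lemma rel_diff: "(x, a) \<in> R \<Longrightarrow> (y, b) \<in> R \<Longrightarrow> (x - y, a - b) \<in> R"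
  using rel_add[OF _ rel_uminus, of x a y b] by simp

lemma rel_sum: "(\<And>i. i \<in> I \<Longrightarrow> (f i, g i) \<in> R) \<Longrightarrow> (sum f I, sum g I) \<in> R"
  by (induction I rule: infinite_finite_induct) (auto intro: rel_zero rel_add)

lemma rel_prod: "(\<And>i. i \<in> I \<Longrightarrow> (f i, g i) \<in> R) \<Longrightarrow> (prod f I, prod g I) \<in> R"
  by (induction I rule: infinite_finite_induct) (auto intro: rel_one rel_mult)

lemma rel_power: "(x, a) \<in> R \<Longrightarrow> (x ^ n, a ^ n) \<in> R"
  by (induction n) (auto intro: rel_one rel_mult)

lemma rel_det:
  assumes "A \<in> carrier_mat n n" "B \<in> carrier_mat n n"
    "\<And>i j. i < n \<Longrightarrow> j < n \<Longrightarrow> (A $$ (i, j), B $$ (i, j)) \<in> R"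
  shows "(det A, det B) \<in> R"
  unfolding det_def'[OF assms(1)] det_def'[OF assms(2)]
proof (intro rel_sum rel_mult rel_prod assms(3))
  show "(signof p, signof p) \<in> R" for p :: "nat \<Rightarrow> nat"
    using rel_one rel_uminus[OF rel_one] by (auto simp: sign_def)
qed (auto simp: permutes_def dest: permutes_in_image)

definition poly_rel :: "('k poly \<times> 'a poly) set" where
  "poly_rel = {(p, q). \<forall>i. (coeff p i, coeff q i) \<in> R}"

lemma poly_rel: "ring_rel poly_rel"
proof
  fix p q p' q'
  assume "(p, q) \<in> poly_rel" "(p', q') \<in> poly_rel"
  then show "(p + p', q + q') \<in> poly_rel" "(p * p', q * q') \<in> poly_rel"
    by (auto simp: poly_rel_def coeff_mult intro: rel_add rel_sum rel_mult)
qed (auto simp: poly_rel_def coeff_1 rel_one rel_zero intro: rel_uminus)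


lemma poly_rel_monom: "(x, a) \<in> R \<Longrightarrow> (monom x n, monom a n) \<in> poly_rel"
  by (auto simp: poly_rel_def coeff_monom intro: rel_zero)

lemma poly_rel_coeff: "(p, q) \<in> poly_rel \<Longrightarrow> (coeff p i, coeff q i) \<in> R"
  by (simp add: poly_rel_def)

end

text \<open>A nonzero ideal of this kind is generated by an element of least degree, which is not
  constant and so has a root. Values of places can therefore be found without enlarging
  \<open>'a\<close>.\<close>

lemma poly_ideal_common_root:
  fixes J :: "'a::alg_closed_field poly set"
  assumes add: "\<And>p q. p \<in> J \<Longrightarrow> q \<in> J \<Longrightarrow> p + q \<in> J"
    and mult: "\<And>p r. p \<in> J \<Longrightarrow> r * p \<in> J"
    and "1 \<notin> J"
  shows "\<exists>c. \<forall>q\<in>J. poly q c = 0"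
proof (cases "J \<subseteq> {0}")
  case False
  then have "\<exists>q. q \<in> J \<and> q \<noteq> 0" by auto
  then obtain q where q: "q \<in> J" "q \<noteq> 0" and
    min: "\<And>p. p \<in> J \<Longrightarrow> p \<noteq> 0 \<Longrightarrow> degree q \<le> degree p"
    using arg_min_nat_lemma[of "\<lambda>q. q \<in> J \<and> q \<noteq> 0" _ degree] by blast
  have "degree q > 0"
  proof (rule ccontr)
    assume "\<not> degree q > 0"
    then obtain c where c: "q = [:c:]" by (auto elim: degree_eq_zeroE)
    with q have "[:inverse c:] * q = 1" by (simp add: one_pCons)
    with mult[OF q(1), of "[:inverse c:]"] \<open>1 \<notin> J\<close> show False by simp
  qed
  then obtain c where c: "poly q c = 0" using alg_closed_imp_poly_has_root by blast
  have "poly p c = 0" if p: "p \<in> J" for p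
  proof -
    have "p mod q = p + (- (p div q)) * q"
      using minus_div_mult_eq_mod[of p q] by simp
    with add[OF p mult[OF q(1), of "- (p div q)"]] have "p mod q \<in> J" by simp
    with min[of "p mod q"] degree_mod_less'[of q p] q(2) have "p mod q = 0" by linarith
    with div_mult_mod_eq[of p q] have "poly p c = poly (p div q * q) c" by simp
    with c show ?thesis by simp
  qed
  then show ?thesis by blast
next
  case True
  then have "poly q 0 = 0" if "q \<in> J" for q using that by auto
  then show ?thesis by blast
qed

text \<open>\<open>rel_zero_left\<close> turns the subring into the graph of a function, a
  homomorphism defined on \<open>Domain R\<close>; \<open>rel_emb\<close> makes it the identity on
  constants.\<close>

locale place_rel = ring_rel R + emb: comm_ring_hom emb
  for emb :: "'a::alg_closed_field \<Rightarrow> 'k::field" and R :: "('k \<times> 'a) set" +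
  assumes rel_emb: "(emb c, c) \<in> R"
    and rel_zero_left: "(0, a) \<in> R \<Longrightarrow> a = 0"
begin

lemma rel_unique: "(x, a) \<in> R \<Longrightarrow> (x, b) \<in> R \<Longrightarrow> a = b"
  using rel_diff[of x a x b] rel_zero_left[of "a - b"] by simp

text \<open>The extension of the homomorphism that gives \<open>x\<close> the value
  \<open>c\<close>. An element may be a polynomial in \<open>x\<close> in many ways;
  \<open>place_rel_adjoin\<close> says when this does no harm.\<close>

definition adjoin :: "'k \<Rightarrow> 'a \<Rightarrow> ('k \<times> 'a) set" where
  "adjoin x c = {(poly p x, poly q c) | p q. (p, q) \<in> poly_rel}"

lemma subset_adjoin: "R \<subseteq> adjoin x c"
proof clarify
  fix y a assume "(y, a) \<in> R"
  from poly_rel_monom[OF this, of 0] show "(y, a) \<in> adjoin x c"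
    unfolding adjoin_def by (auto intro!: exI[of _ "monom y 0"] exI[of _ "monom a 0"] simp: poly_monom)
qed

lemma in_adjoin: "(x, c) \<in> adjoin x c"
  using poly_rel_monom[OF rel_one, of 1] unfolding adjoin_def
  by (auto intro!: exI[of _ "monom 1 1"] simp: poly_monom)

lemma place_rel_adjoin:
  assumes "\<And>p q. (p, q) \<in> poly_rel \<Longrightarrow> poly p x = 0 \<Longrightarrow> poly q c = 0"
  shows "place_rel emb (adjoin x c)"
proof -
  interpret P: ring_rel poly_rel by (rule poly_rel)
  show ?thesis
  proof
    show "(1, 1) \<in> adjoin x c" "\<And>c'. (emb c', c') \<in> adjoin x c"
      using subset_adjoin rel_one rel_emb by auto
    show "(y, b) \<in> adjoin x c \<Longrightarrow> (- y, - b) \<in> adjoin x c" for y b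
      unfolding adjoin_def using P.rel_uminus by (auto) (metis poly_minus)
    show "(y, b) \<in> adjoin x c \<Longrightarrow> (y', b') \<in> adjoin x c \<Longrightarrow> (y + y', b + b') \<in> adjoin x c" for y b y' b'
      unfolding adjoin_def using P.rel_add by (auto) (metis poly_add)
    show "(y, b) \<in> adjoin x c \<Longrightarrow> (y', b') \<in> adjoin x c \<Longrightarrow> (y * y', b * b') \<in> adjoin x c" for y b y' b'
      unfolding adjoin_def using P.rel_mult by (auto) (metis poly_mult)
    show "(0, a) \<in> adjoin x c \<Longrightarrow> a = 0" for a
      unfolding adjoin_def using assms by (auto dest: sym)
  qed
qed

text \<open>The reductions of the polynomial relations of \<open>x\<close>, an ideal by the two
  lemmas below. A common root \<open>c\<close> is an admissible value for \<open>x\<close>.\<close>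

definition vanishing :: "'k \<Rightarrow> 'a poly set" where
  "vanishing x = {q. \<exists>p. (p, q) \<in> poly_rel \<and> poly p x = 0}"

lemma vanishing_add: "p \<in> vanishing x \<Longrightarrow> q \<in> vanishing x \<Longrightarrow> p + q \<in> vanishing x"
  using ring_rel.rel_add[OF poly_rel] unfolding vanishing_def mem_Collect_eq
  by (metis poly_add add_0)

lemma vanishing_mult: "p \<in> vanishing x \<Longrightarrow> r * p \<in> vanishing x"
proof -
  assume "p \<in> vanishing x"
  then obtain p' where p': "(p', p) \<in> poly_rel" "poly p' x = 0" by (auto simp: vanishing_def)
  have "(map_poly emb r, r) \<in> poly_rel"
    by (simp add: poly_rel_def coeff_map_poly rel_emb)
  from ring_rel.rel_mult[OF poly_rel this p'(1)] p'(2) show "r * p \<in> vanishing x"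
    unfolding vanishing_def by force
qed

end

locale maximal_place = place_rel emb R
  for emb :: "'a::alg_closed_field \<Rightarrow> 'k::field" and R +
  assumes maximal: "place_rel emb R' \<Longrightarrow> R \<subseteq> R' \<Longrightarrow> R' = R"
begin

lemma relI_root:
  assumes "\<And>p q. (p, q) \<in> poly_rel \<Longrightarrow> poly p x = 0 \<Longrightarrow> poly q c = 0"
  shows "(x, c) \<in> R"
proof -
  have "place_rel emb (adjoin x c)" by (rule place_rel_adjoin) (rule assms)
  from maximal[OF this subset_adjoin] in_adjoin show ?thesis by blast
qed

text \<open>A relation \<open>p\<close> of the inverse of \<open>y\<close>, multiplied by
  \<open>y ^ n\<close>, is a polynomial expression in \<open>y\<close> itself, to which the place
  already applies. Dividing its residue by \<open>b ^ n\<close> shows that the inverse of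
  \<open>b\<close> is a root of the reduction.\<close>

lemma rel_inverse:
  assumes y: "(y, b) \<in> R" and b: "b \<noteq> 0"
  shows "(inverse y, inverse b) \<in> R"
proof (rule relI_root)
  fix p q assume pq: "(p, q) \<in> poly_rel" "poly p (inverse y) = 0"
  from y b have y0: "y \<noteq> 0" using rel_zero_left by blast
  define n where "n = max (degree p) (degree q)"
  then have n: "degree p \<le> n" "degree q \<le> n" by simp_all
  have eq: "poly r (inverse z) * z ^ n = (\<Sum>i\<le>n. coeff r i * z ^ (n - i))"
    if "degree r \<le> n" "z \<noteq> 0" for r and z :: "'x::field"
  proof -
    have "poly r (inverse z) = (\<Sum>i\<le>n. coeff r i * inverse z ^ i)"
      unfolding poly_altdef by (rule sum.mono_neutral_left) (use that in \<open>auto simp: coeff_eq_0\<close>)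
    then have "poly r (inverse z) * z ^ n = (\<Sum>i\<le>n. coeff r i * inverse z ^ i * z ^ n)"
      by (simp only: sum_distrib_right)
    also have "\<dots> = (\<Sum>i\<le>n. coeff r i * z ^ (n - i))"
      by (rule sum.cong) (use \<open>z \<noteq> 0\<close> in \<open>auto simp: power_diff field_simps\<close>)
    finally show ?thesis .
  qed
  have "((\<Sum>i\<le>n. coeff p i * y ^ (n - i)), (\<Sum>i\<le>n. coeff q i * b ^ (n - i))) \<in> R"
    by (intro rel_sum rel_mult rel_power y poly_rel_coeff[OF pq(1)])
  then have "(poly p (inverse y) * y ^ n, poly q (inverse b) * b ^ n) \<in> R"
    using y0 b n by (simp add: eq)
  then have "poly q (inverse b) * b ^ n = 0" using pq(2) rel_zero_left[of "poly q (inverse b) * b ^ n"] by simp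
  then show "poly q (inverse b) = 0" using b by simp
qed

text \<open>The step of Chevalley's argument. Reduction \<open>1\<close> means that the constant
  coefficient has residue \<open>1\<close> and all others have residue \<open>0\<close>. The
  relation of the inverse expresses \<open>x ^ l\<close> by lower powers of \<open>x\<close>, and
  this replaces the leading term of \<open>p\<close>.\<close>

lemma degree_reduction:
  assumes p: "(p, 1) \<in> poly_rel" "poly p x = 0" "degree p \<le> n"
    and p': "(p', 1) \<in> poly_rel" "poly p' (inverse x) = 0" "degree p' \<le> l"
    and "x \<noteq> 0" "0 < l" "l \<le> n"
  shows "\<exists>r. (r, 1) \<in> poly_rel \<and> poly r x = 0 \<and> degree r \<le> n - 1"
proof -
  interpret P: ring_rel poly_rel by (rule poly_rel)
  define u where "u = inverse (coeff p' 0)"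
  have p'0: "(coeff p' 0, 1) \<in> R" using poly_rel_coeff[OF p'(1), of 0] by simp
  from rel_inverse[OF this] have u: "(u, 1) \<in> R" by (simp add: u_def)
  have u0: "coeff p' 0 * u = 1" using p'0 rel_zero_left[of 1] by (cases "coeff p' 0 = 0") (auto simp: u_def)
  have small: "(coeff p i, 0) \<in> R" "(coeff p' i, 0) \<in> R" if "i > 0" for i
    using poly_rel_coeff[OF p(1), of i] poly_rel_coeff[OF p'(1), of i] that by (auto simp: coeff_1)
  \<comment> \<open>Multiplying the value of \<open>p'\<close> at the inverse of \<open>x\<close> by
    \<open>u * x ^ l\<close> gives \<open>x ^ l + poly s x = 0\<close>, where \<open>s\<close> has
    degree less than \<open>l\<close>.\<close>
  define s where "s = (\<Sum>i\<in>{1..l}. monom (u * coeff p' i) (l - i))"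
  define r where "r = p - monom (coeff p n) n - monom (coeff p n) (n - l) * s"
  have "(s, \<Sum>i\<in>{1..l}. monom (1 * 0) (l - i)) \<in> poly_rel"
    unfolding s_def by (intro P.rel_sum poly_rel_monom rel_mult u small) auto
  then have s_rel: "(s, 0) \<in> poly_rel" by simp
  have n0: "n > 0" using assms by simp
  have "(r, 1 - monom 0 n - monom 0 (n - l) * 0) \<in> poly_rel"
    unfolding r_def by (intro P.rel_diff P.rel_mult poly_rel_monom s_rel small p n0)
  then have r_rel: "(r, 1) \<in> poly_rel" by simp
  have "poly p' (inverse x) = (\<Sum>i\<le>l. coeff p' i * inverse x ^ i)"
    unfolding poly_altdef by (rule sum.mono_neutral_left) (use p'(3) in \<open>auto simp: coeff_eq_0\<close>)
  also have "\<dots> = coeff p' 0 + (\<Sum>i\<in>{1..l}. coeff p' i * inverse x ^ i)"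
    by (simp add: sum.atMost_shift sum.atLeast1_atMost_eq lessThan_Suc_atMost)
  finally have "0 = u * x ^ l * (coeff p' 0 + (\<Sum>i\<in>{1..l}. coeff p' i * inverse x ^ i))"
    using p'(2) by simp
  also have "\<dots> = x ^ l + (\<Sum>i\<in>{1..l}. u * coeff p' i * (x ^ l * inverse x ^ i))"
    using u0 by (simp add: algebra_simps sum_distrib_left)
  also have "(\<Sum>i\<in>{1..l}. u * coeff p' i * (x ^ l * inverse x ^ i)) = poly s x"
    unfolding s_def poly_sum poly_monom
    using \<open>x \<noteq> 0\<close> by (intro sum.cong refl) (auto simp: power_diff power_inverse divide_inverse)
  finally have sx: "poly s x = - (x ^ l)" by (simp add: eq_neg_iff_add_eq_0 add.commute)
  have "poly r x = 0"
    using p(2) \<open>l \<le> n\<close> by (simp add: r_def poly_monom sx mult.assoc flip: power_add)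
  moreover have "degree s \<le> l - 1"
    unfolding s_def by (rule degree_sum_le) (auto intro: order.trans[OF degree_monom_le])
  then have "degree (monom (coeff p n) (n - l) * s) \<le> (n - l) + (l - 1)"
    by (intro order.trans[OF degree_mult_le] add_mono degree_monom_le)
  then have "degree (monom (coeff p n) (n - l) * s) \<le> n - 1" using \<open>0 < l\<close> \<open>l \<le> n\<close> by simp
  moreover have "degree (p - monom (coeff p n) n) \<le> n - 1"
    using p(3) by (intro degree_le) (auto simp: coeff_monom coeff_eq_0)
  ultimately show ?thesis using r_rel degree_diff_le unfolding r_def by blast
qed

text \<open>With relations of least degree for \<open>x\<close> and for its inverse, the one of
  larger degree could be shortened by the other.\<close>

lemma not_both_trivial:
  assumes "x \<noteq> 0" "1 \<in> vanishing x" "1 \<in> vanishing (inverse x)"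
  shows False
proof -
  define S where "S = (\<lambda>y n. \<exists>p. (p, 1) \<in> poly_rel \<and> poly p y = 0 \<and> degree p \<le> n)"
  have ex: "\<exists>n. S x n" "\<exists>n. S (inverse x) n" using assms by (auto simp: S_def vanishing_def)
  have pos: "n > 0" if S: "S y n" for y n
  proof (rule ccontr)
    assume "\<not> n > 0"
    with S obtain p where p: "(p, 1) \<in> poly_rel" "poly p y = 0" "degree p = 0"
      by (auto simp: S_def)
    then have "coeff p 0 = 0" by (auto elim!: degree_eq_zeroE)
    with poly_rel_coeff[OF p(1), of 0] rel_zero_left[of 1] show False by simp
  qed
  have step: "S y (n - 1)" if "S y n" "S (inverse y) l" "l \<le> n" "y \<noteq> 0" for y n l
    using that pos[OF that(2)] degree_reduction[of _ y n _ l] unfolding S_def by blast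
  define n where "n = (LEAST n. S x n)"
  define l where "l = (LEAST n. S (inverse x) n)"
  have n: "S x n" "\<And>k. S x k \<Longrightarrow> n \<le> k" unfolding n_def using ex by (auto intro: LeastI_ex Least_le)
  have l: "S (inverse x) l" "\<And>k. S (inverse x) k \<Longrightarrow> l \<le> k"
    unfolding l_def using ex by (auto intro: LeastI_ex Least_le)
  show False
  proof (cases "l \<le> n")
    case True
    from step[OF n(1) l(1) this assms(1)] n(2) pos[OF n(1)] show False by fastforce
  next
    case False
    then have "S (inverse x) (l - 1)" using step[OF l(1), of n] n(1) assms(1) by simp
    with l(2) pos[OF l(1)] show False by fastforce
  qed
qed

text \<open>One of \<open>x\<close> and its inverse has a proper ideal of reduced relations, whose
  common root is its value. If the inverse has a nonzero value, inverting gives \<open>x\<close> a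
  value as well.\<close>

lemma rel_or_rel_inverse:
  assumes "x \<noteq> 0"
  shows "(\<exists>a. (x, a) \<in> R) \<or> (inverse x, 0) \<in> R"
proof -
  have root: "\<exists>c. (y, c) \<in> R" if "1 \<notin> vanishing y" for y
  proof -
    have "\<exists>c. \<forall>q\<in>vanishing y. poly q c = 0"
      by (rule poly_ideal_common_root) (use that in \<open>auto intro: vanishing_add vanishing_mult\<close>)
    then obtain c where "\<And>q. q \<in> vanishing y \<Longrightarrow> poly q c = 0" by blast
    then show ?thesis using relI_root[of y c] by (auto simp: vanishing_def)
  qed
  consider "1 \<notin> vanishing x" | "1 \<notin> vanishing (inverse x)"
    using not_both_trivial[OF assms] by blast
  then show ?thesis
  proof cases
    case 2
    from root[OF this] obtain c where c: "(inverse x, c) \<in> R" by blast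
    show ?thesis
    proof (cases "c = 0")
      case False
      from rel_inverse[OF c this] show ?thesis by auto
    qed (use c in auto)
  qed (use root in auto)
qed

end

theorem place_extension:
  fixes emb :: "'a::alg_closed_field \<Rightarrow> 'k::field"
  assumes "place_rel emb R\<^sub>0"
  obtains R where "R\<^sub>0 \<subseteq> R" "maximal_place emb R"
proof -
  define A where "A = {R. place_rel emb R \<and> R\<^sub>0 \<subseteq> R}"
  have "\<exists>M\<in>A. \<forall>X\<in>A. M \<subseteq> X \<longrightarrow> X = M"
  proof (rule subset_Zorn_nonempty)
    show "A \<noteq> {}" using assms by (auto simp: A_def)
    fix C assume C: "C \<noteq> {}" "subset.chain A C"
    have CA: "place_rel emb R" "R\<^sub>0 \<subseteq> R" if "R \<in> C" for R
      using C(2) that by (auto simp: subset.chain_def A_def)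
    have two: "\<exists>R\<in>C. u \<in> R \<and> v \<in> R" if "u \<in> \<Union>C" "v \<in> \<Union>C" for u v
    proof -
      from that obtain R R' where R: "R \<in> C" "u \<in> R" "R' \<in> C" "v \<in> R'" by blast
      then have "R \<subseteq> R' \<or> R' \<subseteq> R" using C(2) unfolding subset_chain_def by blast
      with R show ?thesis by blast
    qed
    obtain R\<^sub>1 where R1: "R\<^sub>1 \<in> C" using C(1) by blast
    interpret R1: place_rel emb R\<^sub>1 by (rule CA[OF R1])
    have "place_rel emb (\<Union>C)"
    proof
      show "(1, 1) \<in> \<Union>C" "(emb c, c) \<in> \<Union>C" for c using R1 R1.rel_one R1.rel_emb by blast+
      show "(x + y, a + b) \<in> \<Union>C" "(x * y, a * b) \<in> \<Union>C" if xy: "(x, a) \<in> \<Union>C" "(y, b) \<in> \<Union>C" for x a y b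
      proof -
        from two[OF xy] obtain R where R: "R \<in> C" "(x, a) \<in> R" "(y, b) \<in> R" by blast
        interpret place_rel emb R by (rule CA[OF R(1)])
        from R rel_add rel_mult show "(x + y, a + b) \<in> \<Union>C" "(x * y, a * b) \<in> \<Union>C" by blast+
      qed
      show "(- x, - a) \<in> \<Union>C" if "(x, a) \<in> \<Union>C" for x a
        using that CA by (meson UnionE UnionI place_rel.axioms(1) ring_rel.rel_uminus)
      show "a = 0" if "(0, a) \<in> \<Union>C" for a
        using that CA by (meson UnionE place_rel.rel_zero_left)
    qed
    moreover have "R\<^sub>0 \<subseteq> \<Union>C" using R1 CA by blast
    ultimately show "\<Union>C \<in> A" by (simp add: A_def)
  qed
  then obtain M where M: "M \<in> A" and max: "\<forall>X\<in>A. M \<subseteq> X \<longrightarrow> X = M" by blast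
  from M have M': "place_rel emb M" "R\<^sub>0 \<subseteq> M" by (simp_all add: A_def)
  have "maximal_place emb M"
  proof (intro maximal_place.intro maximal_place_axioms.intro M'(1))
    fix R assume R: "place_rel emb R" "M \<subseteq> R"
    with M'(2) have "R \<in> A" by (auto simp: A_def)
    with max R(2) show "R = M" by blast
  qed
  with M'(2) show thesis by (rule that)
qed

section \<open>The generic point of an orbit\<close>

text \<open>Related polynomials may have different supports, since a nonzero coefficient can have
  residue \<open>0\<close>. Common index sets make their products comparable term by term.\<close>

lemma mult_superset:
  fixes f g :: "('v \<Rightarrow>\<^sub>0 nat) \<Rightarrow>\<^sub>0 'a::comm_ring_1"
  assumes "finite A" "keys f \<subseteq> A" "finite B" "keys g \<subseteq> B"
  shows "f * g = (\<Sum>a\<in>A. \<Sum>b\<in>B. single (a + b) (lookup f a * lookup g b))"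
proof -
  have eq: "h = (\<Sum>e\<in>C. single e (lookup h e))" if "finite C" "keys h \<subseteq> C" for h :: "('v \<Rightarrow>\<^sub>0 nat) \<Rightarrow>\<^sub>0 'a" and C
  proof -
    have "(\<Sum>e\<in>keys h. single e (lookup h e)) = (\<Sum>e\<in>C. single e (lookup h e))"
      by (rule sum.mono_neutral_left) (use that in \<open>auto simp: in_keys_iff\<close>)
    with poly_mapping_decompose[of h] show ?thesis by simp
  qed
  have "f * g = (\<Sum>e\<in>A. single e (lookup f e)) * (\<Sum>e\<in>B. single e (lookup g e))"
    using eq[OF assms(1,2)] eq[OF assms(3,4)] by simp
  also have "\<dots> = (\<Sum>a\<in>A. \<Sum>b\<in>B. single (a + b) (lookup f a * lookup g b))"
    by (simp add: sum_product mult_single)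
  finally show ?thesis .
qed

section \<open>Specialization of coefficients\<close>

context ring_rel
begin

definition coeff_rel :: "((('v \<Rightarrow>\<^sub>0 nat) \<Rightarrow>\<^sub>0 'k) \<times> (('v \<Rightarrow>\<^sub>0 nat) \<Rightarrow>\<^sub>0 'a)) set" where
  "coeff_rel = {(f, g). \<forall>e. (lookup f e, lookup g e) \<in> R}"

lemma coeff_relI: "(\<And>e. (lookup f e, lookup g e) \<in> R) \<Longrightarrow> (f, g) \<in> coeff_rel"
  and coeff_relD: "(f, g) \<in> coeff_rel \<Longrightarrow> (lookup f e, lookup g e) \<in> R"
  by (auto simp: coeff_rel_def)

lemma coeff_rel_single: "(x, a) \<in> R \<Longrightarrow> (single e x, single e a) \<in> coeff_rel"
  by (auto simp: coeff_rel_def lookup_single when_def rel_zero)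

lemma ring_rel_coeff_rel: "ring_rel (coeff_rel :: ((('v \<Rightarrow>\<^sub>0 nat) \<Rightarrow>\<^sub>0 'k) \<times> (('v \<Rightarrow>\<^sub>0 nat) \<Rightarrow>\<^sub>0 'a)) set)"
proof
  fix f f' :: "('v \<Rightarrow>\<^sub>0 nat) \<Rightarrow>\<^sub>0 'k" and g g' :: "('v \<Rightarrow>\<^sub>0 nat) \<Rightarrow>\<^sub>0 'a"
  assume *: "(f, g) \<in> coeff_rel" "(f', g') \<in> coeff_rel"
  then show "(f + f', g + g') \<in> coeff_rel"
    by (auto simp: coeff_rel_def lookup_add intro: rel_add)
  let ?A = "keys f \<union> keys g" and ?B = "keys f' \<union> keys g'"
  show "(f * f', g * g') \<in> coeff_rel"
    by (intro coeff_relI, subst (1 2) mult_superset[of ?A _ ?B])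
       (auto simp: lookup_sum intro!: rel_sum coeff_relD coeff_rel_single rel_mult *)
next
  show "(1 :: ('v \<Rightarrow>\<^sub>0 nat) \<Rightarrow>\<^sub>0 'k, 1 :: ('v \<Rightarrow>\<^sub>0 nat) \<Rightarrow>\<^sub>0 'a) \<in> coeff_rel"
    using coeff_rel_single[OF rel_one, of 0] by simp
qed (auto simp: coeff_rel_def intro: rel_uminus)

lemma coeff_rel_Const: "(x, a) \<in> R \<Longrightarrow> (Const x, Const a) \<in> coeff_rel"
  unfolding Const_def by (rule coeff_rel_single)

lemma coeff_rel_Var: "(Var v, Var v) \<in> coeff_rel"
  unfolding Var_def by (rule coeff_rel_single[OF rel_one])

lemma rel_eval_mpoly:
  assumes "\<phi> 0 = 0" "\<psi> 0 = 0" "\<And>e. (\<phi> (lookup f e), \<psi> (lookup g e)) \<in> R"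
    and "\<And>v. (s v, t v) \<in> R"
  shows "(eval_mpoly \<phi> s f, eval_mpoly \<psi> t g) \<in> R"
proof -
  let ?S = "keys f \<union> keys g"
  have "(\<Sum>e\<in>?S. \<phi> (lookup f e) * eval_monomial s e, \<Sum>e\<in>?S. \<psi> (lookup g e) * eval_monomial t e) \<in> R"
    unfolding eval_monomial_def by (intro rel_sum rel_mult rel_prod rel_power assms)
  then show ?thesis
    using eval_mpoly_superset[of ?S f \<phi> s] eval_mpoly_superset[of ?S g \<psi> t] assms(1,2) by simp
qed

lemma coeff_rel_act:
  assumes fg: "(f, g) \<in> coeff_rel" and M: "\<And>i j. i < m \<Longrightarrow> j < m \<Longrightarrow> (M $$ (i, j), N $$ (i, j)) \<in> R"
    and polys: "f \<in> polys m" "g \<in> polys m"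
  shows "(act m M f, act m N g) \<in> coeff_rel"
proof -
  interpret C: ring_rel "coeff_rel :: (((nat \<Rightarrow>\<^sub>0 nat) \<Rightarrow>\<^sub>0 'k) \<times> ((nat \<Rightarrow>\<^sub>0 nat) \<Rightarrow>\<^sub>0 'a)) set"
    by (rule ring_rel_coeff_rel)
  \<comment> \<open>Rows with index at least \<open>m\<close> lie outside the matrices, where
    nothing is known about the entries; they are replaced by \<open>0\<close>, which is related to
    itself.\<close>
  have "act m M f = subst (\<lambda>i. if i < m then linear_form m M i else 0) f"
    "act m N g = subst (\<lambda>i. if i < m then linear_form m N i else 0) g"
    unfolding act_def using polys by (auto intro: subst_cong_polys)
  moreover have "(linear_form m M i, linear_form m N i) \<in> coeff_rel" if "i < m" for i
    unfolding linear_form_def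
    by (intro C.rel_sum C.rel_mult coeff_rel_Const coeff_rel_Var M) (use that in auto)
  ultimately show ?thesis
    unfolding subst_def
    by (auto intro!: C.rel_eval_mpoly coeff_rel_Const coeff_relD fg C.rel_zero)
qed

end

lemma (in zero_hom) lookup_map_hom: "lookup (Poly_Mapping.map hom f) e = hom (lookup f e)"
  by (simp add: Poly_Mapping.map.rep_eq when_def)

lemma (in zero_hom) map_hom_in_polys: "f \<in> polys m \<Longrightarrow> Poly_Mapping.map hom f \<in> polys m"
  by (intro polysI) (auto simp: in_keys_iff lookup_map_hom dest!: polysD[of f m])

section \<open>The generic matrix of determinant one\<close>

definition const_fract :: "'a::field \<Rightarrow> (nat, 'a) mpoly fract" where
  "const_fract c = Fract (Const c) 1"

lemma comm_ring_hom_const_fract: "comm_ring_hom const_fract"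
  by unfold_locales (simp_all add: const_fract_def Const_hom.hom_add Const_hom.hom_mult Zero_fract_def One_fract_def)

text \<open>Row-major numbering of the entries, from which \<open>specialize\<close> recovers the
  position by \<open>div\<close> and \<open>mod\<close>.\<close>

definition generic_matrix :: "nat \<Rightarrow> (nat, 'a::field) mpoly mat" where
  "generic_matrix m = mat m m (\<lambda>(i, j). Var (i * m + j))"

definition specialize :: "nat \<Rightarrow> 'a mat \<Rightarrow> (nat, 'a::field) mpoly \<Rightarrow> 'a" where
  "specialize m M = eval_mpoly (\<lambda>c. c) (\<lambda>v. M $$ (v div m, v mod m))"

lemma comm_ring_hom_specialize: "comm_ring_hom (specialize m M)"
  unfolding specialize_def by (rule comm_ring_hom.comm_ring_hom_eval_mpoly[OF comm_ring_hom_id])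

lemma map_specialize_generic_matrix:
  assumes "M \<in> carrier_mat m m"
  shows "map_mat (specialize m M) (generic_matrix m) = M"
proof (rule eq_matI)
  fix i j assume "i < dim_row M" "j < dim_col M"
  then have "i < m" "j < m" using assms by auto
  then show "map_mat (specialize m M) (generic_matrix m) $$ (i, j) = M $$ (i, j)"
    by (simp add: generic_matrix_def specialize_def comm_ring_hom.eval_mpoly_Var[OF comm_ring_hom_id])
qed (use assms in \<open>auto simp: generic_matrix_def\<close>)

lemma specialize_det_generic_matrix:
  "M \<in> carrier_mat m m \<Longrightarrow> specialize m M (det (generic_matrix m)) = det M"
  using comm_ring_hom.hom_det[OF comm_ring_hom_specialize, of m M "generic_matrix m"]
  by (simp add: map_specialize_generic_matrix)

lemma det_generic_matrix_nonzero: "det (generic_matrix m :: (nat, 'a::field) mpoly mat) \<noteq> 0"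
proof
  assume 0: "det (generic_matrix m :: (nat, 'a) mpoly mat) = 0"
  interpret comm_ring_hom "specialize m (1\<^sub>m m :: 'a mat)" by (rule comm_ring_hom_specialize)
  show False using specialize_det_generic_matrix[of "1\<^sub>m m :: 'a mat" m] 0 by simp
qed

text \<open>A generic point of the special linear group inside a rational function field: dividing
  one row by the determinant avoids the coordinate ring of the group and the proof that it is a
  domain. At a matrix of determinant one the division has no effect.\<close>

definition generic_SL :: "nat \<Rightarrow> (nat, 'a::field) mpoly fract mat" where
  "generic_SL m = multrow 0 (Fract 1 (det (generic_matrix m))) (map_mat (\<lambda>p. Fract p 1) (generic_matrix m))"

lemma comm_ring_hom_Fract: "comm_ring_hom (\<lambda>p. Fract p 1)"
  by unfold_locales (simp_all add: Zero_fract_def One_fract_def)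

lemma generic_SL_in_SL: "(generic_SL m :: (nat, 'a::field) mpoly fract mat) \<in> SL m"
proof -
  let ?G = "generic_matrix m :: (nat, 'a) mpoly mat"
  have c: "map_mat (\<lambda>p. Fract p 1) ?G \<in> carrier_mat m m" by (simp add: generic_matrix_def)
  have "det (generic_SL m :: (nat, 'a) mpoly fract mat) = 1"
  proof (cases "m = 0")
    case True
    then show ?thesis using c by (intro det_dim_zero) (simp add: generic_SL_def)
  next
    case False
    have "det (map_mat (\<lambda>p. Fract p 1) ?G) = Fract (det ?G) 1"
      by (rule comm_ring_hom.hom_det[OF comm_ring_hom_Fract])
    with False c show ?thesis
      using det_generic_matrix_nonzero[of m, where 'a = 'a] unfolding generic_SL_def
      by (subst det_multrow[of 0 m]) (simp_all add: One_fract_def eq_fract)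
  qed
  with c show ?thesis by (simp add: SL_def generic_SL_def)
qed

text \<open>The graph of evaluation at \<open>M\<close> on the local ring of fractions whose
  denominator does not vanish there.\<close>

definition specialization :: "nat \<Rightarrow> 'a::field mat \<Rightarrow> ((nat, 'a) mpoly fract \<times> 'a) set" where
  "specialization m M = {(Fract a b, specialize m M a / specialize m M b) | a b. specialize m M b \<noteq> 0}"

lemma place_rel_specialization: "place_rel const_fract (specialization m M)"
proof -
  interpret sp: comm_ring_hom "specialize m M" by (rule comm_ring_hom_specialize)
  interpret cf: comm_ring_hom "const_fract :: 'a \<Rightarrow> (nat, 'a) mpoly fract" by (rule comm_ring_hom_const_fract)
  have nz: "b \<noteq> 0" if "specialize m M b \<noteq> 0" for b using that by auto
  have I: "(Fract a b, specialize m M a / specialize m M b) \<in> specialization m M"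
    if "specialize m M b \<noteq> 0" for a b using that by (auto simp: specialization_def)
  have add: "(Fract a b + Fract c d, specialize m M a / specialize m M b + specialize m M c / specialize m M d) \<in> specialization m M"
    if "specialize m M b \<noteq> 0" "specialize m M d \<noteq> 0" for a b c d
    using I[of "b * d" "a * d + c * b"] that nz[OF that(1)] nz[OF that(2)]
    by (simp add: sp.hom_add sp.hom_mult add_frac_eq)
  have mult: "(Fract a b * Fract c d, (specialize m M a / specialize m M b) * (specialize m M c / specialize m M d)) \<in> specialization m M"
    if "specialize m M b \<noteq> 0" "specialize m M d \<noteq> 0" for a b c d
    using I[of "b * d" "a * c"] that by (simp add: sp.hom_mult)
  have uminus: "(- Fract a b, - (specialize m M a / specialize m M b)) \<in> specialization m M"
    if "specialize m M b \<noteq> 0" for a b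
    using I[of b "- a"] that by (simp add: sp.hom_uminus)
  show ?thesis
  proof
    show "(1, 1) \<in> specialization m M" using I[of 1 1] by (simp add: One_fract_def)
    show "(const_fract c, c) \<in> specialization m M" for c
      using I[of 1 "Const c"]
      by (simp add: const_fract_def specialize_def comm_ring_hom.eval_mpoly_Const[OF comm_ring_hom_id]
          comm_ring_hom.eval_mpoly_one[OF comm_ring_hom_id])
    show "(x + y, a + b) \<in> specialization m M" "(x * y, a * b) \<in> specialization m M"
      if "(x, a) \<in> specialization m M" "(y, b) \<in> specialization m M" for x a y b
      using that add mult by (auto simp: specialization_def[of m M])
    show "(- x, - a) \<in> specialization m M" if "(x, a) \<in> specialization m M" for x a
      using that uminus unfolding specialization_def[of m M] by blast
    show "a = 0" if z: "(0, a) \<in> specialization m M" for a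
    proof -
      from z obtain p q where pq: "Fract p q = 0" "a = specialize m M p / specialize m M q" "specialize m M q \<noteq> 0"
        by (auto simp: specialization_def)
      then have "p = 0" using nz[OF pq(3)] by (simp add: Zero_fract_def eq_fract)
      with pq show ?thesis by simp
    qed
  qed
qed

lemma generic_SL_specialization:
  fixes M :: "'a::alg_closed_field mat"
  assumes M: "M \<in> SL m" and ij: "i < m" "j < m"
  shows "(generic_SL m $$ (i, j), M $$ (i, j)) \<in> specialization m M"
proof -
  interpret place_rel const_fract "specialization m M" by (rule place_rel_specialization)
  interpret sp: comm_ring_hom "specialize m M" by (rule comm_ring_hom_specialize)
  have c: "M \<in> carrier_mat m m" "det M = 1" using M by (auto simp: SL_def)
  have "specialize m M (generic_matrix m $$ (i, j)) = map_mat (specialize m M) (generic_matrix m) $$ (i, j)"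
    using ij by (simp add: generic_matrix_def)
  also have "\<dots> = M $$ (i, j)" using c by (simp add: map_specialize_generic_matrix)
  finally have sp_ij: "specialize m M (generic_matrix m $$ (i, j)) = M $$ (i, j)" .
  have I: "(Fract a b, specialize m M a / specialize m M b) \<in> specialization m M"
    if "specialize m M b \<noteq> 0" for a b using that by (auto simp: specialization_def)
  have entry: "(Fract (generic_matrix m $$ (i, j)) 1, M $$ (i, j)) \<in> specialization m M"
    using I[of 1 "generic_matrix m $$ (i, j)"] sp_ij by simp
  have "(Fract 1 (det (generic_matrix m)), 1) \<in> specialization m M"
    using I[of "det (generic_matrix m)" 1] c by (simp add: specialize_det_generic_matrix)
  from rel_mult[OF this entry]
  have "(Fract 1 (det (generic_matrix m)) * Fract (generic_matrix m $$ (i, j)) 1, M $$ (i, j)) \<in> specialization m M"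
    by simp
  with entry show ?thesis using ij
    by (cases "i = 0") (simp_all add: generic_SL_def generic_matrix_def mat_multrow_def del: mult_fract)
qed

theorem place_of_closure_point:
  fixes g :: "(nat, 'a::alg_closed_field) mpoly"
  assumes g: "g \<in> polys m" and f: "f \<in> zariski_closure m (SL_orbit m g)"
  shows "\<exists>R. maximal_place const_fract R \<and>
    (\<forall>e. (lookup (act m (generic_SL m) (Poly_Mapping.map const_fract g)) e, lookup f e) \<in> R)"
proof -
  interpret cf: comm_ring_hom "const_fract :: 'a \<Rightarrow> (nat, 'a) mpoly fract" by (rule comm_ring_hom_const_fract)
  define v where "v = lookup (act m (generic_SL m) (Poly_Mapping.map const_fract g))"
  interpret ev: comm_ring_hom "eval_mpoly const_fract v" by (rule cf.comm_ring_hom_eval_mpoly)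
  interpret ef: comm_ring_hom "eval_mpoly (\<lambda>c. c) (lookup f)" 
    by (rule comm_ring_hom.comm_ring_hom_eval_mpoly[OF comm_ring_hom_id])
  define R\<^sub>0 where "R\<^sub>0 = {(eval_mpoly const_fract v \<Phi>, eval_mpoly (\<lambda>c. c) (lookup f) \<Phi>) | \<Phi>. True}"
  have R0I: "(eval_mpoly const_fract v \<Phi>, eval_mpoly (\<lambda>c. c) (lookup f) \<Phi>) \<in> R\<^sub>0" for \<Phi>
    by (auto simp: R\<^sub>0_def)
  \<comment> \<open>This makes evaluation at \<open>f\<close> well defined. The generic translate
    specializes to every point of the orbit, so a \<Phi> vanishing at it vanishes on the orbit and
    hence on the closure.\<close>
  have zero: "eval_mpoly (\<lambda>c. c) (lookup f) \<Phi> = 0" if \<Phi>: "eval_mpoly const_fract v \<Phi> = 0" for \<Phi>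
  proof -
    let ?Z = "{h \<in> polys m. eval_mpoly (\<lambda>c. c) (lookup h) \<Phi> = 0}"
    have "SL_orbit m g \<subseteq> ?Z"
    proof
      fix h assume h: "h \<in> SL_orbit m g"
      then obtain M where M: "M \<in> SL m" "h = act m M g" by (auto simp: SL_orbit_eq)
      interpret S: place_rel const_fract "specialization m M" by (rule place_rel_specialization)
      have "(Poly_Mapping.map const_fract g, g) \<in> S.coeff_rel"
        by (rule S.coeff_relI) (simp add: cf.lookup_map_hom S.rel_emb)
      then have "(act m (generic_SL m) (Poly_Mapping.map const_fract g), h) \<in> S.coeff_rel"
        unfolding M(2)
        by (rule S.coeff_rel_act[OF _ generic_SL_specialization[OF M(1)] cf.map_hom_in_polys[OF g] g])
      then have "(v e, lookup h e) \<in> specialization m M" for e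
        unfolding v_def by (rule S.coeff_relD)
      from S.rel_eval_mpoly[where \<phi> = const_fract and \<psi> = "\<lambda>c. c" and f = \<Phi> and g = \<Phi>,
          OF cf.hom_zero refl S.rel_emb this]
      have "(eval_mpoly const_fract v \<Phi>, eval_mpoly (\<lambda>c. c) (lookup h) \<Phi>) \<in> specialization m M" .
      then have "eval_mpoly (\<lambda>c. c) (lookup h) \<Phi> = 0"
        unfolding \<Phi> by (rule S.rel_zero_left)
      moreover have "h \<in> polys m" using h SL_orbit_subset_polys by blast
      ultimately show "h \<in> ?Z" by blast
    qed
    moreover have "zariski_closed m ?Z"
      unfolding zariski_closed_def by (intro exI[of _ "{\<Phi>}"]) auto
    ultimately have "zariski_closure m (SL_orbit m g) \<subseteq> ?Z"
      unfolding zariski_closure_def by (rule hull_minimal)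
    with f show ?thesis by blast
  qed
  have "place_rel const_fract R\<^sub>0"
  proof
    show "(1, 1) \<in> R\<^sub>0" using R0I[of 1] by simp
    show "(const_fract c, c) \<in> R\<^sub>0" for c using R0I[of "Const c"]
      by (simp add: comm_ring_hom.eval_mpoly_Const[OF comm_ring_hom_id])
    show "(x + y, a + b) \<in> R\<^sub>0" "(x * y, a * b) \<in> R\<^sub>0" if "(x, a) \<in> R\<^sub>0" "(y, b) \<in> R\<^sub>0" for x a y b
    proof -
      from that obtain \<Phi> \<Psi> where "x = eval_mpoly const_fract v \<Phi>" "a = eval_mpoly (\<lambda>c. c) (lookup f) \<Phi>"
        "y = eval_mpoly const_fract v \<Psi>" "b = eval_mpoly (\<lambda>c. c) (lookup f) \<Psi>" by (auto simp: R\<^sub>0_def)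
      with R0I[of "\<Phi> + \<Psi>"] R0I[of "\<Phi> * \<Psi>"]
      show "(x + y, a + b) \<in> R\<^sub>0" "(x * y, a * b) \<in> R\<^sub>0"
        by (simp_all add: ev.hom_add ev.hom_mult ef.hom_add ef.hom_mult)
    qed
    show "(- x, - a) \<in> R\<^sub>0" if "(x, a) \<in> R\<^sub>0" for x a
    proof -
      from that obtain \<Phi> where "x = eval_mpoly const_fract v \<Phi>" "a = eval_mpoly (\<lambda>c. c) (lookup f) \<Phi>"
        by (auto simp: R\<^sub>0_def)
      with R0I[of "- \<Phi>"] show ?thesis by (simp add: ev.hom_uminus ef.hom_uminus)
    qed
    show "a = 0" if "(0, a) \<in> R\<^sub>0" for a using that zero by (auto simp: R\<^sub>0_def)
  qed
  from place_extension[OF this] obtain R where R: "R\<^sub>0 \<subseteq> R" "maximal_place const_fract R" .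
  have "(v e, lookup f e) \<in> R" for e
    using R0I[of "Var e"] R(1) by (auto simp: comm_ring_hom.eval_mpoly_Var[OF comm_ring_hom_id])
  with R(2) show ?thesis unfolding v_def by blast
qed

section \<open>Linear functionals on preordered lattices\<close>

lemma strictly_between_finite_sets:
  fixes A B :: "real set"
  assumes "finite A" "finite B" "\<And>a b. a \<in> A \<Longrightarrow> b \<in> B \<Longrightarrow> a < b"
  shows "\<exists>x. (\<forall>a\<in>A. a < x) \<and> (\<forall>b\<in>B. x < b)"
proof (cases "A = {} \<or> B = {}")
  case True
  then show ?thesis
  proof
    assume "A = {}"
    have "\<forall>b\<in>B. Min (insert 0 B) - 1 < b"
    proof
      fix b assume "b \<in> B"
      then have "Min (insert 0 B) \<le> b" using assms(2) by (intro Min_le) auto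
      then show "Min (insert 0 B) - 1 < b" by linarith
    qed
    with \<open>A = {}\<close> show ?thesis by auto
  next
    assume "B = {}"
    have "\<forall>a\<in>A. a < Max (insert 0 A) + 1"
    proof
      fix a assume "a \<in> A"
      then have "a \<le> Max (insert 0 A)" using assms(1) by (intro Max_ge) auto
      then show "a < Max (insert 0 A) + 1" by linarith
    qed
    with \<open>B = {}\<close> show ?thesis by auto
  qed
next
  case False
  then have "Max A < Min B" using assms by auto
  then obtain x where "Max A < x" "x < Min B" using dense by blast
  with assms False show ?thesis by (meson Max_ge Min_le le_less_trans less_le_trans)
qed

text \<open>
  Total preorders of the group \<open>\<int>\<^sup>m\<close> are locally given by real linear functionals. The induction
  eliminates the last coordinate as in the Fourier--Motzkin algorithm.
\<close>

lemma total_preorder_linear_functional: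
  fixes P :: "(nat \<Rightarrow> int) set"
  assumes add: "\<And>u v. u \<in> P \<Longrightarrow> v \<in> P \<Longrightarrow> (\<lambda>i. u i + v i) \<in> P"
    and total: "\<And>u. u \<in> P \<or> (\<lambda>i. - u i) \<in> P"
  shows "finite E \<Longrightarrow> (\<And>e i. e \<in> E \<Longrightarrow> m \<le> i \<Longrightarrow> e i = 0) \<Longrightarrow>
    \<exists>w :: nat \<Rightarrow> real. \<forall>e\<in>E. e \<in> P \<longleftrightarrow> 0 \<le> (\<Sum>i<m. w i * e i)"
proof (induction m arbitrary: E)
  case 0
  have "(\<lambda>i. 0) \<in> P" using total[of "\<lambda>i. 0"] by simp
  moreover have "e = (\<lambda>i. 0)" if "e \<in> E" for e using 0(2)[OF that] by auto
  ultimately show ?case by auto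
next
  case (Suc m)
  have mult_nat: "(\<lambda>i. int n * u i) \<in> P" if "u \<in> P" for n u
  proof (induction n)
    case (Suc n)
    from add[OF that this] show ?case by (simp add: algebra_simps)
  qed (use total[of "\<lambda>i. 0"] in simp)
  have mult: "(\<lambda>i. a * u i) \<in> P" if "u \<in> P" "0 < a" for a u
    using mult_nat[OF that(1), of "nat a"] that(2) by simp
  \<comment> \<open>Otherwise the negative of \<open>u\<close> would lie in \<open>P\<close>, and
    adding \<open>a - 1\<close> copies of it to \<open>a\<close> times \<open>u\<close> gives back
    \<open>u\<close>.\<close>
  have cancel: "u \<in> P" if "(\<lambda>i. a * u i) \<in> P" "0 < a" for a u
  proof (rule ccontr)
    assume "u \<notin> P"
    then have "(\<lambda>i. - u i) \<in> P" using total by blast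
    from add[OF mult_nat[OF this, of "nat (a - 1)"] that(1)] that(2)
    have "(\<lambda>i. (a - 1) * - u i + a * u i) \<in> P" by simp
    also have "(\<lambda>i. (a - 1) * - u i + a * u i) = u" by (auto simp: algebra_simps)
    finally show False using \<open>u \<notin> P\<close> by blast
  qed
  \<comment> \<open>The vectors with nonzero last coordinate, with the sign chosen to make it
    positive.\<close>
  define E\<^sub>p where "E\<^sub>p = {e \<in> E \<union> (\<lambda>e i. - e i) ` E. 0 < e m}"
  \<comment> \<open>The combination that eliminates coordinate \<open>m\<close>. It lies in
    \<open>P\<close> exactly when \<open>r e \<le> r f\<close>, so the smaller dimension fixes the
    order of the thresholds \<open>r\<close>.\<close>
  define cross where "cross = (\<lambda>e f i. f m * e i - e m * f i :: int)"
  define E' where "E' = {e \<in> E. e m = 0} \<union> (\<lambda>(e, f). cross e f) ` (E\<^sub>p \<times> E\<^sub>p)"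
  have fin: "finite E\<^sub>p" using Suc.prems(1) by (simp add: E\<^sub>p_def)
  have zero: "e i = 0" if "e \<in> E\<^sub>p" "Suc m \<le> i" for e i
    using that Suc.prems(2) by (auto simp: E\<^sub>p_def)
  have "\<exists>w :: nat \<Rightarrow> real. \<forall>e\<in>E'. e \<in> P \<longleftrightarrow> 0 \<le> (\<Sum>i<m. w i * e i)"
  proof (rule Suc.IH)
    show "finite E'" using Suc.prems(1) fin by (simp add: E'_def)
    fix e i assume "e \<in> E'" "m \<le> i"
    then consider "e \<in> E" "e m = 0" | a b where "a \<in> E\<^sub>p" "b \<in> E\<^sub>p" "e = cross a b"
      by (auto simp: E'_def)
    then show "e i = 0"
    proof cases
      case 1
      with Suc.prems(2)[of e i] \<open>m \<le> i\<close> show ?thesis by (cases "i = m") auto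
    next
      case 2
      with zero[of a i] zero[of b i] \<open>m \<le> i\<close> show ?thesis
        by (cases "i = m") (auto simp: cross_def)
    qed
  qed
  then obtain w where w: "\<And>e. e \<in> E' \<Longrightarrow> e \<in> P \<longleftrightarrow> 0 \<le> (\<Sum>i<m. w i * real_of_int (e i))" by blast
  define s where "s = (\<lambda>e :: nat \<Rightarrow> int. \<Sum>i<m. w i * real_of_int (e i))"
  \<comment> \<open>The value of the new weight \<open>x\<close> for which
    \<open>s e + x * e m\<close> vanishes.\<close>
  define r where "r = (\<lambda>e. - s e / real_of_int (e m))"
  have pos: "0 < e m" if "e \<in> E\<^sub>p" for e using that by (simp add: E\<^sub>p_def)
  have r_le: "r e \<le> r f \<longleftrightarrow> cross e f \<in> P" if "e \<in> E\<^sub>p" "f \<in> E\<^sub>p" for e f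
  proof -
    have "r e \<le> r f \<longleftrightarrow> 0 \<le> f m * s e - e m * s f"
      using pos[OF that(1)] pos[OF that(2)] by (simp add: r_def field_simps)
    also have "f m * s e - e m * s f = (\<Sum>i<m. w i * cross e f i)"
      by (simp add: s_def cross_def sum_distrib_left sum_subtractf algebra_simps)
    finally show ?thesis using w[of "cross e f"] that by (auto simp: E'_def)
  qed
  have cross_add: "(\<lambda>i. cross e f i + e m * f i) \<in> P \<longleftrightarrow> e \<in> P"
    "(\<lambda>i. cross e f i + f m * - e i) \<in> P \<longleftrightarrow> (\<lambda>i. - f i) \<in> P" if "e \<in> E\<^sub>p" "f \<in> E\<^sub>p" for e f
  proof -
    have eq: "(\<lambda>i. cross e f i + e m * f i) = (\<lambda>i. f m * e i)"
      "(\<lambda>i. cross e f i + f m * - e i) = (\<lambda>i. e m * - f i)"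
      by (auto simp: cross_def)
    show "(\<lambda>i. cross e f i + e m * f i) \<in> P \<longleftrightarrow> e \<in> P"
      unfolding eq using mult[of e "f m"] cancel[of "f m" e] pos[OF that(2)] by auto
    show "(\<lambda>i. cross e f i + f m * - e i) \<in> P \<longleftrightarrow> (\<lambda>i. - f i) \<in> P"
      unfolding eq using mult[of "\<lambda>i. - f i" "e m"] cancel[of "e m" "\<lambda>i. - f i"] pos[OF that(1)] by auto
  qed
  have le: "r e \<le> r f" if "e \<in> E\<^sub>p" "f \<in> E\<^sub>p" "e \<in> P" "(\<lambda>i. - f i) \<in> P" for e f
  proof -
    have "(\<lambda>i. f m * e i + e m * - f i) \<in> P"
      using add[OF mult[OF that(3) pos[OF that(2)]] mult[OF that(4) pos[OF that(1)]]] .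
    then show ?thesis using r_le[OF that(1,2)] by (simp add: cross_def)
  qed
  have less1: "r e < r f" if "e \<in> E\<^sub>p" "f \<in> E\<^sub>p" "e \<in> P" "f \<notin> P" for e f
  proof (rule ccontr)
    assume "\<not> r e < r f"
    then have "cross f e \<in> P" using r_le[OF that(2,1)] by simp
    from add[OF this mult[OF that(3) pos[OF that(2)]]] have "f \<in> P"
      using cross_add(1)[OF that(2,1)] by simp
    with that show False by blast
  qed
  have less2: "r e < r f" if "e \<in> E\<^sub>p" "f \<in> E\<^sub>p" "(\<lambda>i. - f i) \<in> P" "(\<lambda>i. - e i) \<notin> P" for e f
  proof (rule ccontr)
    assume "\<not> r e < r f"
    then have "cross f e \<in> P" using r_le[OF that(2,1)] by simp
    from add[OF this mult[OF that(3) pos[OF that(1)]]] have "(\<lambda>i. - e i) \<in> P"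
      using cross_add(2)[OF that(2,1)] by simp
    with that show False by blast
  qed
  \<comment> \<open>A vector equivalent to zero forces \<open>x\<close> to be its threshold. Without
    one, the thresholds of members and of nonmembers are separated by a strict gap, and any
    \<open>x\<close> inside it will do.\<close>
  have "\<exists>x. \<forall>e\<in>E\<^sub>p. (e \<in> P \<longleftrightarrow> r e \<le> x) \<and> ((\<lambda>i. - e i) \<in> P \<longleftrightarrow> x \<le> r e)"
  proof (cases "\<exists>z\<in>E\<^sub>p. z \<in> P \<and> (\<lambda>i. - z i) \<in> P")
    case True
    then obtain z where z: "z \<in> E\<^sub>p" "z \<in> P" "(\<lambda>i. - z i) \<in> P" by blast
    show ?thesis
    proof (intro exI[of _ "r z"] ballI conjI iffI)
      fix e assume e: "e \<in> E\<^sub>p"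
      show "e \<in> P \<Longrightarrow> r e \<le> r z" "(\<lambda>i. - e i) \<in> P \<Longrightarrow> r z \<le> r e"
        using le e z by blast+
      show "e \<in> P" if "r e \<le> r z" using less1[OF z(1) e z(2)] that by force
      show "(\<lambda>i. - e i) \<in> P" if "r z \<le> r e" using less2[OF e z(1) z(3)] that by force
    qed
  next
    case False
    then have iff: "(\<lambda>i. - e i) \<in> P \<longleftrightarrow> e \<notin> P" if "e \<in> E\<^sub>p" for e using that total by blast
    have "\<exists>x. (\<forall>a\<in>r ` {e \<in> E\<^sub>p. e \<in> P}. a < x) \<and> (\<forall>b\<in>r ` {e \<in> E\<^sub>p. e \<notin> P}. x < b)"
      by (rule strictly_between_finite_sets) (use fin less1 in auto)
    then obtain x where "\<And>e. e \<in> E\<^sub>p \<Longrightarrow> e \<in> P \<Longrightarrow> r e < x" "\<And>e. e \<in> E\<^sub>p \<Longrightarrow> e \<notin> P \<Longrightarrow> x < r e"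
      by blast
    with iff show ?thesis by (intro exI[of _ x]) (metis less_imp_le not_le)
  qed
  then obtain x where x: "\<And>e. e \<in> E\<^sub>p \<Longrightarrow> e \<in> P \<longleftrightarrow> r e \<le> x"
    "\<And>e. e \<in> E\<^sub>p \<Longrightarrow> (\<lambda>i. - e i) \<in> P \<longleftrightarrow> x \<le> r e" by blast
  show ?case
  proof (intro exI[of _ "w(m := x)"] ballI)
    fix e assume e: "e \<in> E"
    have sum: "(\<Sum>i<Suc m. (w(m := x)) i * real_of_int (e i)) = s e + x * e m"
      by (simp add: s_def)
    consider "e m = 0" | "0 < e m" | "e m < 0" by linarith
    then show "e \<in> P \<longleftrightarrow> 0 \<le> (\<Sum>i<Suc m. (w(m := x)) i * real_of_int (e i))"
    proof cases
      case 1
      with e w[of e] show ?thesis unfolding sum by (simp add: E'_def s_def)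
    next
      case 2
      with e have "e \<in> E\<^sub>p" by (simp add: E\<^sub>p_def)
      from x(1)[OF this] 2 show ?thesis unfolding sum by (simp add: r_def field_simps) linarith
    next
      case 3
      with e have "(\<lambda>i. - e i) \<in> E\<^sub>p" by (auto simp: E\<^sub>p_def)
      from x(2)[OF this] 3 show ?thesis
        unfolding sum by (simp add: r_def s_def sum_negf field_simps) linarith
    qed
  qed
qed

section \<open>Diagonalization over a valuation ring\<close>

text \<open>The condition on \<open>c\<close>, which includes \<open>c k = 0\<close>, makes the
  matrix triangular with unit diagonal.\<close>

lemma det_elementary:
  fixes c :: "nat \<Rightarrow> 'a::idom"
  assumes "k < m" "(\<forall>i\<le>k. c i = 0) \<or> (\<forall>i\<ge>k. c i = 0)"
  shows "det (mat m m (\<lambda>(i, j). (if i = j then 1 else 0) + (if j = k then c i else 0))) = 1"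
    (is "det ?L = 1")
proof -
  have diag: "prod_list (diag_mat ?L) = 1"
    using assms unfolding prod_list_diag_prod by (intro prod.neutral) auto
  show ?thesis
  proof (cases "\<forall>i\<le>k. c i = 0")
    case True
    have "det ?L = prod_list (diag_mat ?L)"
      by (rule det_lower_triangular[of m]) (use True in auto)
    with diag show ?thesis by simp
  next
    case False
    with assms have "\<forall>i\<ge>k. c i = 0" by blast
    then have "upper_triangular ?L" by (auto simp: upper_triangular_def)
    from det_upper_triangular[OF this, of m] diag show ?thesis by simp
  qed
qed

locale valuation_ring =
  fixes V :: "'k::field set"
  assumes one: "1 \<in> V"
    and add: "x \<in> V \<Longrightarrow> y \<in> V \<Longrightarrow> x + y \<in> V"
    and mult: "x \<in> V \<Longrightarrow> y \<in> V \<Longrightarrow> x * y \<in> V"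
    and uminus: "x \<in> V \<Longrightarrow> - x \<in> V"
    and inverse: "x \<notin> V \<Longrightarrow> inverse x \<in> V"
begin

lemma zero: "0 \<in> V"
  using add[OF one uminus[OF one]] by simp

lemma sum: "(\<And>i. i \<in> I \<Longrightarrow> f i \<in> V) \<Longrightarrow> sum f I \<in> V"
  by (induction I rule: infinite_finite_induct) (auto intro: zero add)

text \<open>A valuation ring is local: two elements differing by \<open>1\<close> cannot both be
  nonunits.\<close>

lemma unit_or_unit_plus_one:
  assumes "q \<in> V"
  shows "inverse q \<in> V \<or> (1 + q \<noteq> 0 \<and> inverse (1 + q) \<in> V)"
proof (cases "inverse q \<in> V")
  case False
  then have q: "q \<noteq> 0" using zero by auto
  have "1 + q \<noteq> 0"
  proof
    assume "1 + q = 0"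
    then have "q = - 1" by (simp add: eq_neg_iff_add_eq_0 add.commute)
    with False uminus[OF one] show False by simp
  qed
  moreover have "q / (1 + q) \<in> V"
  proof (rule ccontr)
    assume "q / (1 + q) \<notin> V"
    from inverse[OF this] have "(1 + q) / q \<in> V" by simp
    from add[OF this uminus[OF one]] q have "inverse q \<in> V" by (simp add: field_simps)
    with False show False by blast
  qed
  from add[OF one uminus[OF this]] \<open>1 + q \<noteq> 0\<close> have "inverse (1 + q) \<in> V"
    by (simp add: field_simps)
  ultimately show ?thesis by blast
qed simp

text \<open>Comparison of valuations, that of \<open>x\<close> being the smaller or equal
  one.\<close>

definition divides :: "'k \<Rightarrow> 'k \<Rightarrow> bool" where
  "divides x y \<longleftrightarrow> (\<exists>q\<in>V. y = q * x)"

lemma divides_refl: "divides x x"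
  using one by (auto simp: divides_def)

lemma divides_trans: "divides x y \<Longrightarrow> divides y z \<Longrightarrow> divides x z"
  unfolding divides_def by (metis mult mult.assoc)

lemma divides_total: "divides x y \<or> divides y x"
proof (cases "x = 0")
  case True
  then show ?thesis using zero by (auto simp: divides_def)
next
  case False
  show ?thesis
  proof (cases "y / x \<in> V")
    case True
    with False show ?thesis by (auto simp: divides_def intro!: bexI[of _ "y / x"])
  next
    case False
    from inverse[OF this] have "x / y \<in> V" by simp
    moreover have "y \<noteq> 0" using False zero by auto
    ultimately show ?thesis by (auto simp: divides_def intro!: bexI[of _ "x / y"])
  qed
qed

lemma divides_add: "divides x y \<Longrightarrow> divides x z \<Longrightarrow> divides x (y + z)"
  unfolding divides_def by (metis add distrib_right)

lemma ex_divides_all: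
  assumes "finite S" "S \<noteq> {}"
  shows "\<exists>p\<in>S. \<forall>y\<in>S. divides p y"
  using assms
proof (induction S rule: finite_ne_induct)
  case (insert x F)
  then obtain p where p: "p \<in> F" "\<And>y. y \<in> F \<Longrightarrow> divides p y" by blast
  show ?case
    using divides_total[of x p] p divides_trans divides_refl by (metis insert_iff)
qed (auto intro: divides_refl)

definition integral_SL :: "nat \<Rightarrow> 'k mat set" where
  "integral_SL m = {A \<in> SL m. \<forall>i<m. \<forall>j<m. A $$ (i, j) \<in> V}"

lemma integral_SL_carrier: "A \<in> integral_SL m \<Longrightarrow> A \<in> carrier_mat m m"
  by (simp add: integral_SL_def SL_def)

lemma integral_SL_one: "1\<^sub>m m \<in> integral_SL m"
  using one zero by (auto simp: integral_SL_def SL_def)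

lemma integral_SL_mult:
  assumes "A \<in> integral_SL m" "B \<in> integral_SL m"
  shows "A * B \<in> integral_SL m"
proof -
  have "(A * B) $$ (i, j) \<in> V" if "i < m" "j < m" for i j
    using that assms by (auto simp: integral_SL_def SL_def scalar_prod_def intro!: sum mult)
  then show ?thesis using assms by (auto simp: integral_SL_def SL_def det_mult)
qed

lemma integral_SL_transpose: "A \<in> integral_SL m \<Longrightarrow> transpose_mat A \<in> integral_SL m"
  by (auto simp: integral_SL_def SL_def det_transpose)

text \<open>Equivalence by independent factors on the two sides, as for the Smith normal form, not
  conjugacy. The entries of \<open>M\<close> and \<open>N\<close> may lie outside
  \<open>V\<close>.\<close>

definition similar :: "nat \<Rightarrow> 'k mat \<Rightarrow> 'k mat \<Rightarrow> bool" where
  "similar m M N \<longleftrightarrow> N \<in> carrier_mat m m \<and> (\<exists>A\<in>integral_SL m. \<exists>B\<in>integral_SL m. M = A * N * B)"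

lemma similar_refl: "M \<in> carrier_mat m m \<Longrightarrow> similar m M M"
  unfolding similar_def using integral_SL_one[of m]
  by (metis left_mult_one_mat right_mult_one_mat)

lemma similar_trans:
  assumes "similar m M N" "similar m N L"
  shows "similar m M L"
proof -
  from assms obtain A B A' B' where *: "A \<in> integral_SL m" "B \<in> integral_SL m"
    "A' \<in> integral_SL m" "B' \<in> integral_SL m" "M = A * N * B" "N = A' * L * B'" "L \<in> carrier_mat m m"
    unfolding similar_def by blast
  note c = *(7) *(1-4)[THEN integral_SL_carrier]
  have "M = (A * A') * L * (B' * B)"
    using c unfolding *(5,6) by (simp add: assoc_mult_mat[of _ m m _ m _ m])
  with * integral_SL_mult show ?thesis unfolding similar_def by blast
qed

lemma similar_transpose:
  assumes "similar m M N"
  shows "similar m (transpose_mat M) (transpose_mat N)"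
proof -
  from assms obtain A B where *: "A \<in> integral_SL m" "B \<in> integral_SL m" "M = A * N * B" "N \<in> carrier_mat m m"
    unfolding similar_def by blast
  note c = *(4) *(1,2)[THEN integral_SL_carrier]
  have "transpose_mat M = transpose_mat B * transpose_mat N * transpose_mat A"
    using c unfolding *(3)
    by (simp add: transpose_mult[of _ m m _ m] assoc_mult_mat[of _ m m _ m _ m])
  with * integral_SL_transpose show ?thesis unfolding similar_def by (metis transpose_carrier_mat)
qed

lemma similar_row_operation:
  assumes M: "M \<in> carrier_mat m m" and k: "k < m"
    and c: "(\<forall>i\<le>k. c i = 0) \<or> (\<forall>i\<ge>k. c i = 0)" "\<And>i. c i \<in> V"
  shows "similar m M (mat m m (\<lambda>(i, j). M $$ (i, j) - c i * M $$ (k, j)))" (is "similar m M ?N")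
proof -
  let ?L = "mat m m (\<lambda>(i, j). (if i = j then 1 else 0) + (if j = k then c i else 0))"
  have L: "?L \<in> integral_SL m"
    using det_elementary[OF k c(1)] c(2) one zero by (auto simp: integral_SL_def SL_def add)
  have ck: "c k = 0" using c(1) by auto
  have "M = ?L * ?N"
  proof (rule eq_matI)
    fix i j assume "i < dim_row (?L * ?N)" "j < dim_col (?L * ?N)"
    then have ij: "i < m" "j < m" by auto
    have "(?L * ?N) $$ (i, j) = (\<Sum>l<m. ((if i = l then 1 else 0) + (if l = k then c i else 0)) * ?N $$ (l, j))"
      using ij by (simp add: scalar_prod_def lessThan_atLeast0)
    also have "\<dots> = (\<Sum>l<m. (if l = i then ?N $$ (i, j) else 0) + (if l = k then c i * ?N $$ (k, j) else 0))"
      by (intro sum.cong) (auto simp: distrib_right)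
    also have "\<dots> = ?N $$ (i, j) + c i * ?N $$ (k, j)"
      using ij k by (simp add: sum.distrib)
    also have "\<dots> = M $$ (i, j)" using ij k ck by simp
    finally show "M $$ (i, j) = (?L * ?N) $$ (i, j)" by simp
  qed (use M in auto)
  also have "?L * ?N = ?L * ?N * 1\<^sub>m m" by (simp add: right_mult_one_mat[of _ m m])
  finally have "M = ?L * ?N * 1\<^sub>m m" .
  moreover have "?N \<in> carrier_mat m m" by simp
  ultimately show ?thesis using L integral_SL_one[of m] unfolding similar_def by blast
qed

definition partially_diagonal :: "nat \<Rightarrow> nat \<Rightarrow> 'k mat \<Rightarrow> bool" where
  "partially_diagonal m k M \<longleftrightarrow> (\<forall>i<m. \<forall>j<m. i \<noteq> j \<longrightarrow> i < k \<or> j < k \<longrightarrow> M $$ (i, j) = 0)"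

definition divides_block :: "nat \<Rightarrow> nat \<Rightarrow> 'k \<Rightarrow> 'k mat \<Rightarrow> bool" where
  "divides_block m k x M \<longleftrightarrow> (\<forall>i\<in>{k..<m}. \<forall>j\<in>{k..<m}. divides x (M $$ (i, j)))"

lemma partially_diagonal_transpose:
  "M \<in> carrier_mat m m \<Longrightarrow> partially_diagonal m k M \<Longrightarrow> partially_diagonal m k (transpose_mat M)"
  by (auto simp: partially_diagonal_def)

lemma divides_block_transpose:
  "M \<in> carrier_mat m m \<Longrightarrow> divides_block m k x M \<Longrightarrow> divides_block m k x (transpose_mat M)"
  by (auto simp: divides_block_def)

text \<open>Exchanging two rows has determinant \<open>-1\<close>, so row \<open>i\<^sub>0\<close>
  is added to row \<open>k\<close> instead, and only if the entry of row \<open>k\<close> is not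
  itself a pivot. Then \<open>q\<close> is a nonunit, \<open>1 + q\<close> is a unit, and the new
  entry \<open>(1 + q) * ?p\<close> divides as much as \<open>?p\<close>.\<close>

lemma move_pivot_row:
  assumes M: "M \<in> carrier_mat m m" "partially_diagonal m k M"
    and ij: "k \<le> i\<^sub>0" "i\<^sub>0 < m" "k \<le> j\<^sub>0" "j\<^sub>0 < m" and div: "divides_block m k (M $$ (i\<^sub>0, j\<^sub>0)) M"
  shows "\<exists>N. similar m M N \<and> partially_diagonal m k N \<and> divides_block m k (N $$ (k, j\<^sub>0)) N"
proof -
  let ?p = "M $$ (i\<^sub>0, j\<^sub>0)"
  have "divides ?p (M $$ (k, j\<^sub>0))" using div ij by (auto simp: divides_block_def)
  then obtain q where q: "q \<in> V" "M $$ (k, j\<^sub>0) = q * ?p" by (auto simp: divides_def)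
  show ?thesis
  proof (cases "divides (M $$ (k, j\<^sub>0)) ?p")
    case True
    then have "divides_block m k (M $$ (k, j\<^sub>0)) M"
      using div divides_trans unfolding divides_block_def by blast
    with M similar_refl show ?thesis by blast
  next
    case False
    \<comment> \<open>The case \<open>q = 0\<close> is separate because \<open>inverse 0 = 0\<close>
      lies in \<open>V\<close>.\<close>
    have "inverse q \<notin> V \<or> q = 0"
    proof (rule ccontr)
      assume "\<not> (inverse q \<notin> V \<or> q = 0)"
      then have "inverse q \<in> V" "?p = inverse q * M $$ (k, j\<^sub>0)" using q(2) by simp_all
      with False show False unfolding divides_def by blast
    qed
    then have u: "inverse (1 + q) \<in> V" "1 + q \<noteq> 0"
      using unit_or_unit_plus_one[OF q(1)] one by auto
    have "k \<noteq> i\<^sub>0" using False divides_refl by auto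
    define c where "c = (\<lambda>i. if i = k then - 1 else 0 :: 'k)"
    define N where "N = mat m m (\<lambda>(i, j). M $$ (i, j) - c i * M $$ (i\<^sub>0, j))"
    have "similar m M N" unfolding N_def
      by (rule similar_row_operation) (use M ij \<open>k \<noteq> i\<^sub>0\<close> one zero uminus in \<open>auto simp: c_def\<close>)
    moreover have "partially_diagonal m k N"
      using M(2) ij unfolding partially_diagonal_def N_def c_def by auto
    moreover have "N $$ (k, j\<^sub>0) = (1 + q) * ?p"
      using ij q(2) by (simp add: N_def c_def algebra_simps)
    then have "divides (N $$ (k, j\<^sub>0)) ?p"
      unfolding divides_def using u by (auto intro!: bexI[of _ "inverse (1 + q)"])
    moreover have "divides_block m k ?p N"
      using div ij uminus[OF one] zero
      by (auto simp: divides_block_def N_def c_def intro!: divides_add)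
    ultimately show ?thesis using divides_trans unfolding divides_block_def by blast
  qed
qed

lemma clear_column:
  assumes M: "M \<in> carrier_mat m m" "partially_diagonal m k M" and k: "k < m"
    and div: "\<And>i. k < i \<Longrightarrow> i < m \<Longrightarrow> divides (M $$ (k, k)) (M $$ (i, k))"
  shows "\<exists>N. similar m M N \<and> partially_diagonal m k N \<and>
    (\<forall>i<m. k < i \<longrightarrow> N $$ (i, k) = 0) \<and> (\<forall>j<m. N $$ (k, j) = M $$ (k, j))"
proof -
  \<comment> \<open>A zero pivot divides only zero, so division by zero gives the right multiplier
    \<open>0\<close> in that case.\<close>
  define c where "c = (\<lambda>i. if k < i \<and> i < m then M $$ (i, k) / M $$ (k, k) else 0)"
  define N where "N = mat m m (\<lambda>(i, j). M $$ (i, j) - c i * M $$ (k, j))"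
  have c: "c i \<in> V" for i
    using div[of i] zero by (auto simp: c_def divides_def)
  have c': "c i * M $$ (k, k) = M $$ (i, k)" if "k < i" "i < m" for i
    using div[OF that] that by (auto simp: c_def divides_def)
  have "similar m M N" unfolding N_def
    by (rule similar_row_operation) (use M k c in \<open>auto simp: c_def\<close>)
  moreover have "partially_diagonal m k N"
    using M(2) k unfolding partially_diagonal_def N_def c_def by auto
  moreover have "N $$ (i, k) = 0" if "i < m" "k < i" for i
    using that k c' by (simp add: N_def)
  moreover have "N $$ (k, j) = M $$ (k, j)" if "j < m" for j
    using that k by (simp add: N_def c_def)
  ultimately show ?thesis by blast
qed

lemma similar_carrier: "similar m M N \<Longrightarrow> N \<in> carrier_mat m m"
  by (simp add: similar_def)

lemma similar_transpose':
  "M \<in> carrier_mat m m \<Longrightarrow> similar m (transpose_mat M) N \<Longrightarrow> similar m M (transpose_mat N)"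
  using similar_transpose by fastforce

text \<open>Column operations are row operations on the transpose; moving the pivot and clearing are
  done once for each side.\<close>

lemma diagonalize_step:
  assumes M: "M \<in> carrier_mat m m" "partially_diagonal m k M" and k: "k < m"
  shows "\<exists>N. similar m M N \<and> partially_diagonal m (Suc k) N"
proof -
  define S where "S = (\<lambda>(i, j). M $$ (i, j)) ` ({k..<m} \<times> {k..<m})"
  have "finite S" "S \<noteq> {}" using k by (auto simp: S_def)
  from ex_divides_all[OF this] obtain i j where ij: "i \<in> {k..<m}" "j \<in> {k..<m}"
    and "\<forall>y\<in>S. divides (M $$ (i, j)) y" by (auto simp: S_def)
  then have "divides_block m k (M $$ (i, j)) M" by (auto simp: divides_block_def S_def)
  from move_pivot_row[OF M _ _ _ _ this] ij obtain M1 where M1: "similar m M M1"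
    "partially_diagonal m k M1" "divides_block m k (M1 $$ (k, j)) M1" by auto
  let ?T = "transpose_mat M1"
  have M1c: "M1 \<in> carrier_mat m m" using M1(1) by (rule similar_carrier)
  have "divides_block m k (?T $$ (j, k)) ?T"
    using divides_block_transpose[OF M1c M1(3)] M1c ij k by simp
  from move_pivot_row[OF _ partially_diagonal_transpose[OF M1c M1(2)] _ _ _ _ this] ij k M1c
  obtain M2 where M2: "similar m ?T M2" "partially_diagonal m k M2" "divides_block m k (M2 $$ (k, k)) M2"
    by auto
  have M2c: "M2 \<in> carrier_mat m m" using M2(1) by (rule similar_carrier)
  from clear_column[OF M2c M2(2) k] M2(3) obtain M3 where M3: "similar m M2 M3" "partially_diagonal m k M3"
    "\<And>i. i < m \<Longrightarrow> k < i \<Longrightarrow> M3 $$ (i, k) = 0" "\<And>j. j < m \<Longrightarrow> M3 $$ (k, j) = M2 $$ (k, j)"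
    by (auto simp: divides_block_def)
  have M3c: "M3 \<in> carrier_mat m m" using M3(1) by (rule similar_carrier)
  have sim3: "similar m M (transpose_mat M3)"
    using similar_trans[OF M1(1) similar_transpose'[OF M1c similar_trans[OF M2(1) M3(1)]]] .
  let ?T3 = "transpose_mat M3"
  have T3c: "?T3 \<in> carrier_mat m m" using M3c by simp
  have "divides (?T3 $$ (k, k)) (?T3 $$ (i, k))" if "k < i" "i < m" for i
    using that M3(4)[of i] M3(4)[of k] k M2(3) M3c by (auto simp: divides_block_def)
  from clear_column[OF T3c partially_diagonal_transpose[OF M3c M3(2)] k this]
  obtain N where N: "similar m ?T3 N" "partially_diagonal m k N"
    "\<And>i. i < m \<Longrightarrow> k < i \<Longrightarrow> N $$ (i, k) = 0" "\<And>j. j < m \<Longrightarrow> N $$ (k, j) = ?T3 $$ (k, j)"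
    by blast
  \<comment> \<open>The second clearing leaves row \<open>k\<close> alone, so the zeros that the
    first one produced in column \<open>k\<close> survive as a row of the transpose.\<close>
  have "N $$ (k, j) = 0" if "j < m" "k < j" for j
    using N(4)[OF that(1)] M3(3)[OF that] M3c that k by simp
  with N(2,3) have "partially_diagonal m (Suc k) N"
    unfolding partially_diagonal_def less_Suc_eq by (metis linorder_neqE_nat)
  with similar_trans[OF sim3 N(1)] show ?thesis by blast
qed

text \<open>A Cartan decomposition over a valuation ring with arbitrary value group, without any
  ordering of the diagonal entries.\<close>

theorem diagonalize:
  assumes "M \<in> carrier_mat m m"
  shows "\<exists>A\<in>integral_SL m. \<exists>B\<in>integral_SL m. \<exists>D\<in>carrier_mat m m. M = A * D * B \<and>
    (\<forall>i<m. \<forall>j<m. i \<noteq> j \<longrightarrow> D $$ (i, j) = 0)"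
proof -
  have "\<exists>N. similar m M N \<and> partially_diagonal m k N" if "k \<le> m" for k
    using that
  proof (induction k)
    case 0
    then show ?case using similar_refl[OF assms] by (auto simp: partially_diagonal_def)
  next
    case (Suc k)
    then obtain N where N: "similar m M N" "partially_diagonal m k N" by auto
    from diagonalize_step[OF similar_carrier[OF N(1)] N(2)] Suc.prems
    obtain L where L: "similar m N L" "partially_diagonal m (Suc k) L" by auto
    from similar_trans[OF N(1) L(1)] L(2) show ?case by blast
  qed
  then obtain D where D: "similar m M D" "partially_diagonal m m D" by blast
  then have "\<forall>i<m. \<forall>j<m. i \<noteq> j \<longrightarrow> D $$ (i, j) = 0" by (simp add: partially_diagonal_def)
  with D(1) show ?thesis unfolding similar_def by blast
qed

end

section \<open>Torus translates\<close>

text \<open>Over a finite field, adding \<open>1\<close> to the product of all monic linear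
  polynomials gives a polynomial without roots.\<close>

lemma infinite_UNIV_alg_closed_field: "infinite (UNIV :: 'a::alg_closed_field set)"
proof
  assume fin: "finite (UNIV :: 'a set)"
  define p where "p = (\<Prod>a\<in>(UNIV :: 'a set). [:- a, 1:])"
  have "degree p = card (UNIV :: 'a set)" unfolding p_def by (subst degree_prod_sum_eq) auto
  then have "degree p > 0" using fin by (simp add: finite_UNIV_card_ge_0)
  then have "degree (p + 1) > 0" by (subst degree_add_eq_left) auto
  then obtain c where "poly (p + 1) c = 0" using alg_closed_imp_poly_has_root by blast
  moreover have "poly p c = 0" unfolding p_def poly_prod by (rule prod_zero[OF fin]) auto
  ultimately show False by simp
qed

lemma laurent_polynomial_vanishes:
  fixes C :: "'i \<Rightarrow> 'k::field" and \<zeta> :: "'i \<Rightarrow> int"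
  assumes "finite S" "infinite X" "0 \<notin> X"
    and X: "\<And>t. t \<in> X \<Longrightarrow> (\<Sum>\<mu>\<in>S. C \<mu> * t powi \<zeta> \<mu>) = 0" and "t \<noteq> 0"
  shows "(\<Sum>\<mu>\<in>S. C \<mu> * t powi \<zeta> \<mu>) = 0"
proof -
  \<comment> \<open>A shift that makes every exponent nonnegative.\<close>
  define N where "N = (\<Sum>\<mu>\<in>S. \<bar>\<zeta> \<mu>\<bar>)"
  have N: "\<zeta> \<mu> + N \<ge> 0" if "\<mu> \<in> S" for \<mu>
    using member_le_sum[of \<mu> S "\<lambda>\<mu>. \<bar>\<zeta> \<mu>\<bar>"] that assms(1) by (simp add: N_def)
  define p where "p = (\<Sum>\<mu>\<in>S. monom (C \<mu>) (nat (\<zeta> \<mu> + N)))"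
  have p: "poly p s = s powi N * (\<Sum>\<mu>\<in>S. C \<mu> * s powi \<zeta> \<mu>)" if "s \<noteq> 0" for s
  proof -
    have "poly p s = (\<Sum>\<mu>\<in>S. C \<mu> * s ^ nat (\<zeta> \<mu> + N))"
      by (simp add: p_def poly_sum poly_monom)
    also have "\<dots> = (\<Sum>\<mu>\<in>S. s powi N * (C \<mu> * s powi \<zeta> \<mu>))"
    proof (rule sum.cong[OF refl])
      fix \<mu> assume "\<mu> \<in> S"
      then have "s ^ nat (\<zeta> \<mu> + N) = s powi (\<zeta> \<mu> + N)"
        using N by (simp add: power_int_def)
      also have "\<dots> = s powi \<zeta> \<mu> * s powi N" using that by (simp add: power_int_add)
      finally show "C \<mu> * s ^ nat (\<zeta> \<mu> + N) = s powi N * (C \<mu> * s powi \<zeta> \<mu>)" by simp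
    qed
    finally show ?thesis by (simp add: sum_distrib_left)
  qed
  have "p = 0"
  proof (rule ccontr)
    assume "p \<noteq> 0"
    have "X \<subseteq> {s. poly p s = 0}"
    proof
      fix s assume "s \<in> X"
      with p[of s] X[of s] assms(3) show "s \<in> {s. poly p s = 0}" by fastforce
    qed
    with poly_roots_finite[OF \<open>p \<noteq> 0\<close>] assms(2) show False by (meson finite_subset)
  qed
  with p[OF \<open>t \<noteq> 0\<close>] \<open>t \<noteq> 0\<close> show ?thesis by simp
qed

lemma (in comm_ring_hom) hom_eval_mpoly:
  "hom (eval_mpoly (\<lambda>c. c) s f) = eval_mpoly hom (\<lambda>v. hom (s v)) f"
  by (simp add: eval_mpoly_def hom_sum hom_mult hom_prod hom_power)

lemma eval_monomial_power_int:
  "eval_monomial (\<lambda>v. x v * t powi \<zeta> v) \<mu> = eval_monomial x \<mu> * t powi (\<Sum>v\<in>keys \<mu>. \<zeta> v * int (lookup \<mu> v))"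
  if "t \<noteq> 0" for t :: "'k::field"
proof -
  have "(\<Prod>v\<in>A. t powi (\<zeta> v * int (lookup \<mu> v))) = t powi (\<Sum>v\<in>A. \<zeta> v * int (lookup \<mu> v))" if "finite A" for A
    using that by (induction A rule: finite_induct) (simp_all add: power_int_add \<open>t \<noteq> 0\<close>)
  then show ?thesis
    by (simp add: eval_monomial_def power_mult_distrib prod.distrib power_int_mult)
qed

locale stable_points =
  emb: comm_ring_hom emb for emb :: "'a::alg_closed_field \<Rightarrow> 'k::field" +
  fixes m :: nat and T :: "(nat, 'a) mpoly set"
  assumes polys: "T \<subseteq> polys m" and stable: "f \<in> T \<Longrightarrow> M \<in> SL m \<Longrightarrow> act m M f \<in> T"
begin

text \<open>The points over \<open>'k\<close> of the Zariski closure of \<open>T\<close>.\<close>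

definition base_change :: "((nat \<Rightarrow>\<^sub>0 nat) \<Rightarrow> 'k) set" where
  "base_change = {v. \<forall>\<Phi>. (\<forall>f\<in>T. eval_mpoly (\<lambda>c. c) (lookup f) \<Phi> = 0) \<longrightarrow> eval_mpoly emb v \<Phi> = 0}"

lemma in_base_change: "f \<in> T \<Longrightarrow> (\<lambda>e. emb (lookup f e)) \<in> base_change"
  unfolding base_change_def using emb.hom_eval_mpoly[symmetric, of "lookup f"] by simp

text \<open>Translation by a torus point over \<open>'a\<close> preserves \<open>T\<close>, so
  \<Phi> composed with it is again an equation of \<open>T\<close>.\<close>

lemma base_change_torus_base:
  assumes y: "(\<Prod>i<m. y i) = 1" and v: "v \<in> base_change"
  shows "(\<lambda>e. v e * eval_monomial (\<lambda>i. emb (y i)) e) \<in> base_change"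
  unfolding base_change_def
proof (intro CollectI allI impI)
  fix \<Phi> assume \<Phi>: "\<forall>f\<in>T. eval_mpoly (\<lambda>c. c) (lookup f) \<Phi> = 0"
  define \<Psi> where "\<Psi> = subst (\<lambda>e. Const (eval_monomial y e) * Var e) \<Phi>"
  define D where "D = mat m m (\<lambda>(i, j). if i = j then y i else 0)"
  have D: "D \<in> SL m"
  proof -
    have "det D = prod_list (diag_mat D)"
      by (rule det_upper_triangular[of _ m]) (auto simp: D_def upper_triangular_def)
    also have "\<dots> = 1" using y by (simp add: prod_list_diag_prod D_def lessThan_atLeast0)
    finally show ?thesis by (simp add: SL_def D_def)
  qed
  have "eval_mpoly (\<lambda>c. c) (lookup f) \<Psi> = 0" if f: "f \<in> T" for f
  proof -
    have "eval_mpoly (\<lambda>c. c) (lookup f) \<Psi> = eval_mpoly (\<lambda>c. c) (\<lambda>e. eval_monomial y e * lookup f e) \<Phi>"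
      unfolding \<Psi>_def comm_ring_hom.eval_mpoly_subst[OF comm_ring_hom_id]
      by (simp add: comm_ring_hom.eval_mpoly_mult[OF comm_ring_hom_id]
          comm_ring_hom.eval_mpoly_Const[OF comm_ring_hom_id] comm_ring_hom.eval_mpoly_Var[OF comm_ring_hom_id])
    also have "(\<lambda>e. eval_monomial y e * lookup f e) = lookup (act m D f)"
    proof
      fix e
      have "f \<in> polys m" using f polys by blast
      then show "eval_monomial y e * lookup f e = lookup (act m D f) e"
        by (subst lookup_act_diagonal[of f m D y]) (auto simp: D_def)
    qed
    also have "eval_mpoly (\<lambda>c. c) \<dots> \<Phi> = 0" using \<Phi> stable[OF f D] by blast
    finally show ?thesis .
  qed
  with v have "eval_mpoly emb v \<Psi> = 0" by (simp add: base_change_def)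
  also have "eval_mpoly emb v \<Psi> = eval_mpoly emb (\<lambda>e. emb (eval_monomial y e) * v e) \<Phi>"
    unfolding \<Psi>_def emb.eval_mpoly_subst by (simp add: emb.eval_mpoly_mult)
  finally show "eval_mpoly emb (\<lambda>e. v e * eval_monomial (\<lambda>i. emb (y i)) e) \<Phi> = 0"
    by (simp add: emb.hom_eval_monomial mult.commute)
qed

text \<open>Along the one-parameter torus an equation of \<open>T\<close> becomes a Laurent
  polynomial in \<open>t\<close>. It vanishes at the infinitely many nonzero constants by the
  previous lemma, hence at every nonzero \<open>t\<close>.\<close>

lemma base_change_one_parameter:
  assumes il: "i < m" "l < m" "i \<noteq> l" and t: "t \<noteq> 0" and v: "v \<in> base_change"
  shows "(\<lambda>e. v e * eval_monomial ((\<lambda>_. 1)(i := t, l := inverse t)) e) \<in> base_change"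
  unfolding base_change_def
proof (intro CollectI allI impI)
  fix \<Phi> assume \<Phi>: "\<forall>f\<in>T. eval_mpoly (\<lambda>c. c) (lookup f) \<Phi> = 0"
  define \<zeta> where "\<zeta> = (\<lambda>e :: nat \<Rightarrow>\<^sub>0 nat. int (lookup e i) - int (lookup e l))"
  have mon: "eval_monomial ((\<lambda>_. 1)(i := s, l := inverse s)) e = s powi \<zeta> e" if "s \<noteq> 0" for s :: 'k and e
  proof -
    have "eval_monomial ((\<lambda>_. 1)(i := s, l := inverse s)) e
      = (\<Prod>v\<in>keys e \<union> {i, l}. ((\<lambda>_. 1)(i := s, l := inverse s)) v ^ lookup e v)"
      by (rule eval_monomial_superset) auto
    also have "\<dots> = (\<Prod>v\<in>{i, l}. ((\<lambda>_. 1)(i := s, l := inverse s)) v ^ lookup e v)"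
      by (rule prod.mono_neutral_right) auto
    also have "\<dots> = s powi \<zeta> e"
      using il that by (simp add: \<zeta>_def power_int_diff divide_inverse power_inverse)
    finally show ?thesis .
  qed
  define \<xi> where "\<xi> = (\<lambda>\<mu>. \<Sum>e\<in>keys \<mu>. \<zeta> e * int (lookup \<mu> e))"
  define C where "C = (\<lambda>\<mu>. emb (lookup \<Phi> \<mu>) * eval_monomial v \<mu>)"
  have eq: "eval_mpoly emb (\<lambda>e. v e * eval_monomial ((\<lambda>_. 1)(i := s, l := inverse s)) e) \<Phi>
      = (\<Sum>\<mu>\<in>keys \<Phi>. C \<mu> * s powi \<xi> \<mu>)" if "s \<noteq> 0" for s
    by (simp add: mon[OF that] eval_mpoly_superset[of "keys \<Phi>"] C_def \<xi>_def mult.assoc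
        eval_monomial_power_int[OF that])
  have "(\<Sum>\<mu>\<in>keys \<Phi>. C \<mu> * t powi \<xi> \<mu>) = 0"
  proof (rule laurent_polynomial_vanishes[of _ "emb ` (UNIV - {0})"])
    have inj: "inj emb"
    proof (rule injI)
      fix a b assume "emb a = emb b"
      then have "emb (a - b) = 0" by (simp add: emb.hom_minus)
      moreover have "emb (a - b) * emb (inverse (a - b)) = 1" if "a \<noteq> b"
        using that by (simp flip: emb.hom_mult)
      ultimately show "a = b" by force
    qed
    then show "infinite (emb ` (UNIV - {0}))"
      using infinite_UNIV_alg_closed_field by (simp add: finite_image_iff inj_on_def)
    show "0 \<notin> emb ` (UNIV - {0})" using inj by (auto dest: injD[of emb 0])
    fix s assume "s \<in> emb ` (UNIV - {0})"
    then obtain a where a: "s = emb a" "a \<noteq> 0" by auto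
    then have s: "s \<noteq> 0" using inj by (metis emb.hom_zero injD)
    have inv: "emb (inverse a) = inverse s"
      using a(2) by (intro inverse_unique[symmetric]) (simp add: a(1) flip: emb.hom_mult)
    define y where "y = (\<lambda>_. 1)(i := a, l := inverse a)"
    have "(\<Prod>k<m. y k) = (\<Prod>k\<in>{i, l}. y k)"
      by (rule prod.mono_neutral_right) (use il in \<open>auto simp: y_def\<close>)
    then have "(\<Prod>k<m. y k) = 1" using il a by (simp add: y_def)
    from base_change_torus_base[OF this v] \<Phi>
    have "eval_mpoly emb (\<lambda>e. v e * eval_monomial (\<lambda>i. emb (y i)) e) \<Phi> = 0" by (simp add: base_change_def)
    also have "(\<lambda>i. emb (y i)) = (\<lambda>_. 1)(i := s, l := inverse s)" by (auto simp: y_def a(1) inv[unfolded a(1)])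
    finally show "(\<Sum>\<mu>\<in>keys \<Phi>. C \<mu> * s powi \<xi> \<mu>) = 0" unfolding eq[OF s] .
  qed (use t in auto)
  then show "eval_mpoly emb (\<lambda>e. v e * eval_monomial ((\<lambda>_. 1)(i := t, l := inverse t)) e) \<Phi> = 0"
    by (simp add: eq[OF t])
qed

text \<open>The torus element is a product of \<open>m - 1\<close> one-parameter factors, each
  pairing a coordinate with the last one, \<open>l\<close>. The value \<open>1\<close> beyond
  \<open>m\<close> is demanded because exponents outside the \<open>m\<close> variables are
  evaluated too.\<close>

lemma base_change_torus:
  assumes y: "(\<Prod>i<m. y i) = 1" "\<And>i. m \<le> i \<Longrightarrow> y i = 1" and v: "v \<in> base_change"
  shows "(\<lambda>e. v e * eval_monomial y e) \<in> base_change"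
proof (cases "m = 0")
  case True
  then have "y = (\<lambda>_. 1)" using y(2) by auto
  then show ?thesis using v by (simp add: eval_monomial_def)
next
  case False
  then obtain l where l: "m = Suc l" by (cases m) auto
  have nz: "y i \<noteq> 0" if "i < m" for i using y(1) that by (metis finite_lessThan lessThan_iff prod_zero zero_neq_one)
  \<comment> \<open>The product of the first \<open>k\<close> factors, with coordinate
    \<open>l\<close> absorbing the inverse of their entries. At \<open>k = l\<close> this inverse is
    \<open>y l\<close>, since the whole product is \<open>1\<close>.\<close>
  define y' where "y' = (\<lambda>k i. if i < k then y i else if i = l then inverse (\<Prod>j<k. y j) else 1)"
  have "(\<lambda>e. v e * eval_monomial (y' k) e) \<in> base_change" if "k \<le> l" for k
    using that
  proof (induction k)
    case 0
    have "y' 0 = (\<lambda>_. 1)" by (auto simp: y'_def)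
    then show ?case using v by (simp add: eval_monomial_def)
  next
    case (Suc k)
    then have k: "k < m" "l < m" "k \<noteq> l" using l by auto
    have "y' (Suc k) = (\<lambda>i. y' k i * ((\<lambda>_. 1)(k := y k, l := inverse (y k))) i)"
      using k Suc.prems by (auto simp: y'_def fun_eq_iff less_Suc_eq)
    then have "eval_monomial (y' (Suc k)) e = eval_monomial (y' k) e * eval_monomial ((\<lambda>_. 1)(k := y k, l := inverse (y k))) e" for e
      by (simp only: eval_monomial_mult)
    then show ?case
      using base_change_one_parameter[OF k nz[OF k(1)] Suc.IH] Suc.prems by (simp add: mult.assoc)
  qed
  moreover have "y' l = y"
  proof
    fix i
    have "(\<Prod>j<l. y j) * y l = 1" using y(1) by (simp add: l)
    then have "inverse (\<Prod>j<l. y j) = y l" by (rule inverse_unique)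
    then show "y' l i = y i" using y(2)[of i] by (auto simp: y'_def l)
  qed
  ultimately show ?thesis by (metis order.refl)
qed

end

section \<open>Integral matrices and their residues\<close>

context maximal_place
begin

lemma valuation_ring_Domain: "valuation_ring (Domain R)"
proof
  fix x :: 'k
  assume "x \<notin> Domain R"
  moreover from this have "x \<noteq> 0" using rel_zero by auto
  ultimately show "inverse x \<in> Domain R" using rel_or_rel_inverse by blast
qed (auto intro: rel_one rel_add rel_mult rel_uminus)

sublocale V: valuation_ring "Domain R" by (rule valuation_ring_Domain)

definition residue_mat :: "nat \<Rightarrow> 'k mat \<Rightarrow> 'a mat" where
  "residue_mat m A = mat m m (\<lambda>(i, j). SOME a. (A $$ (i, j), a) \<in> R)"

lemma rel_residue_mat:
  assumes "A $$ (i, j) \<in> Domain R" "i < m" "j < m"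
  shows "(A $$ (i, j), residue_mat m A $$ (i, j)) \<in> R"
  using assms by (auto simp: residue_mat_def intro: someI)

lemma det_in_Domain:
  assumes "A \<in> carrier_mat n n" "\<And>i j. i < n \<Longrightarrow> j < n \<Longrightarrow> A $$ (i, j) \<in> Domain R"
  shows "det A \<in> Domain R"
  using rel_det[of A n "residue_mat n A"] rel_residue_mat[of A] assms by (auto simp: residue_mat_def)

lemma residue_mat_in_SL:
  assumes "A \<in> V.integral_SL m"
  shows "residue_mat m A \<in> SL m"
proof -
  have A: "A \<in> carrier_mat m m" "det A = 1" "\<And>i j. i < m \<Longrightarrow> j < m \<Longrightarrow> A $$ (i, j) \<in> Domain R"
    using assms by (auto simp: V.integral_SL_def SL_def)
  have c: "residue_mat m A \<in> carrier_mat m m" by (simp add: residue_mat_def)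
  have "(det A, det (residue_mat m A)) \<in> R"
    using A c rel_residue_mat by (intro rel_det) auto
  then have "det (residue_mat m A) = 1" using rel_unique rel_one by (simp add: A(2))
  with c show ?thesis by (simp add: SL_def)
qed

text \<open>For determinant one the inverse is the adjugate, whose entries are signed minors and so
  stay in the valuation ring.\<close>

lemma integral_SL_inverse:
  assumes "B \<in> V.integral_SL m"
  obtains B' where "B' \<in> V.integral_SL m" "B * B' = 1\<^sub>m m"
proof
  have B: "B \<in> carrier_mat m m" "det B = 1" "\<And>i j. i < m \<Longrightarrow> j < m \<Longrightarrow> B $$ (i, j) \<in> Domain R"
    using assms by (auto simp: V.integral_SL_def SL_def)
  have inv: "B * adj_mat B = 1\<^sub>m m" using adj_mat(2)[OF B(1)] B(2) by (auto intro: eq_matI)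
  then show "B * adj_mat B = 1\<^sub>m m" .
  have c: "adj_mat B \<in> carrier_mat m m" by (rule adj_mat(1)[OF B(1)])
  have "det (adj_mat B) = 1" using det_mult[OF B(1) c] inv B(2) by simp
  moreover have "adj_mat B $$ (i, j) \<in> Domain R" if "i < m" "j < m" for i j
  proof -
    have "det (mat_delete B j i) \<in> Domain R"
    proof (rule det_in_Domain)
      show "mat_delete B j i \<in> carrier_mat (m - 1) (m - 1)" using B(1) by (rule mat_delete_carrier)
      fix a b assume "a < m - 1" "b < m - 1"
      then show "mat_delete B j i $$ (a, b) \<in> Domain R"
        using B(1) by (auto simp: mat_delete_def intro!: B(3))
    qed
    then obtain b where "(det (mat_delete B j i), b) \<in> R" by blast
    then have "((- 1) ^ (j + i) * det (mat_delete B j i), (- 1) ^ (j + i) * b) \<in> R"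
      by (intro rel_mult rel_power rel_uminus rel_one)
    moreover have "adj_mat B $$ (i, j) = (- 1) ^ (j + i) * det (mat_delete B j i)"
      using that B(1) by (simp add: adj_mat_def cofactor_def)
    ultimately show ?thesis by (metis DomainI)
  qed
  ultimately show "adj_mat B \<in> V.integral_SL m" using c by (auto simp: V.integral_SL_def SL_def)
qed

end

section \<open>Closed orbits and faces of Newton polytopes\<close>

lemma prod_inverse: "(\<Prod>i\<in>A. inverse (f i)) = inverse (\<Prod>i\<in>A. f i :: 'k::field)"
  using prod_inversef[of f A] by (simp add: o_def)

lemma lookup_scaleR: "lookup (r *\<^sub>R v) i = r *\<^sub>R lookup v i" for v :: "'v \<Rightarrow>\<^sub>0 real"
proof -
  have "finite {i. r *\<^sub>R lookup v i \<noteq> 0}"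
    by (rule finite_subset[OF _ finite_keys[of v]]) (auto simp: in_keys_iff)
  then show ?thesis unfolding scaleR_poly_mapping_def by (simp add: Abs_poly_mapping_inverse)
qed

lemma lookup_exponent_vector: "lookup (exponent_vector e) i = real (lookup e i)"
  unfolding exponent_vector_def by (simp add: Poly_Mapping.map.rep_eq when_def)

lemma lookup_restrict_to:
  "lookup (restrict_to f Q) e = (if exponent_vector e \<in> Q then lookup f e else 0)"
  unfolding restrict_to_def
  by (simp add: lookup_sum lookup_single when_def sum.If_cases in_keys_iff)

text \<open>The face is cut out at level \<open>0\<close>, not at the minimum of the weight. If all
  weights are positive it is empty, and the restriction is the zero polynomial.\<close>

lemma NPT_weight_face:
  fixes w :: "nat \<Rightarrow> real"
  assumes "\<And>e. e \<in> keys f \<Longrightarrow> 0 \<le> (\<Sum>i<m. w i * real (lookup e i))"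
  shows "\<exists>Q\<in>faces (NPT f). \<forall>e.
    lookup (restrict_to f Q) e = (if (\<Sum>i<m. w i * real (lookup e i)) = 0 then lookup f e else 0)"
proof (intro bexI allI)
  define l where "l = (\<lambda>v :: nat \<Rightarrow>\<^sub>0 real. \<Sum>i<m. w i * lookup v i)"
  have lin: "linear l"
    by (rule linearI) (simp_all add: l_def lookup_add lookup_scaleR sum.distrib algebra_simps sum_distrib_left)
  have l: "l (exponent_vector e) = (\<Sum>i<m. w i * real (lookup e i))" for e
    by (simp add: l_def lookup_exponent_vector)
  have "convex {v. 0 \<le> l v}"
    by (rule convexI) (simp add: linear_add[OF lin] linear_scale[OF lin])
  then have "NPT f \<subseteq> {v. 0 \<le> l v}"
    unfolding NPT_def by (intro hull_minimal) (use assms l in auto)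
  with lin show "NPT f \<inter> {v. l v = 0} \<in> faces (NPT f)" unfolding faces_def by blast
  fix e
  have "exponent_vector e \<in> NPT f" if "lookup f e \<noteq> 0"
    unfolding NPT_def using that by (intro hull_inc) (auto simp: in_keys_iff)
  then show "lookup (restrict_to f (NPT f \<inter> {v. l v = 0})) e
    = (if (\<Sum>i<m. w i * real (lookup e i)) = 0 then lookup f e else 0)"
    by (auto simp: lookup_restrict_to l)
qed

context maximal_place
begin

lemma not_in_Domain_inverse: "x \<notin> Domain R \<Longrightarrow> (inverse x, 0) \<in> R"
proof -
  assume x: "x \<notin> Domain R"
  then have "x \<noteq> 0" using rel_zero by auto
  from rel_or_rel_inverse[OF this] x show ?thesis by blast
qed

text \<open>Membership of Laurent monomials in \<open>d\<close> in the valuation ring is a total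
  preorder of the lattice. Each exponent is tested with both signs, so that weight \<open>0\<close>
  singles out the units.\<close>

lemma torus_weights:
  assumes d: "\<And>i. d i \<noteq> 0" and E: "finite E" "\<And>e. e \<in> E \<Longrightarrow> keys e \<subseteq> {..<m}"
  shows "\<exists>w :: nat \<Rightarrow> real. \<forall>e\<in>E.
    (eval_monomial d e \<in> Domain R \<longleftrightarrow> 0 \<le> (\<Sum>i<m. w i * real (lookup e i))) \<and>
    (inverse (eval_monomial d e) \<in> Domain R \<longleftrightarrow> (\<Sum>i<m. w i * real (lookup e i)) \<le> 0)"
proof -
  define P where "P = {u :: nat \<Rightarrow> int. (\<Prod>i<m. d i powi u i) \<in> Domain R}"
  define pos where "pos = (\<lambda>(e :: nat \<Rightarrow>\<^sub>0 nat) i. int (lookup e i))"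
  define neg where "neg = (\<lambda>(e :: nat \<Rightarrow>\<^sub>0 nat) i. - int (lookup e i))"
  have "\<exists>w :: nat \<Rightarrow> real. \<forall>e\<in>pos ` E \<union> neg ` E. e \<in> P \<longleftrightarrow> 0 \<le> (\<Sum>i<m. w i * real_of_int (e i))"
  proof (rule total_preorder_linear_functional)
    fix u v assume "u \<in> P" "v \<in> P"
    then show "(\<lambda>i. u i + v i) \<in> P"
      using V.mult by (simp add: P_def power_int_add d prod.distrib)
  next
    fix u :: "nat \<Rightarrow> int"
    show "u \<in> P \<or> (\<lambda>i. - u i) \<in> P"
      using V.inverse[of "\<Prod>i<m. d i powi u i"]
      by (auto simp: P_def power_int_minus prod_inverse)
  next
    show "finite (pos ` E \<union> neg ` E)" using E(1) by simp
    fix e i assume e: "e \<in> pos ` E \<union> neg ` E" and i: "m \<le> i"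
    have "lookup e' i = 0" if "e' \<in> E" for e'
      using E(2)[OF that] i by (meson in_keys_iff lessThan_iff not_le subsetD)
    with e show "e i = 0" by (auto simp: pos_def neg_def)
  qed
  then obtain w :: "nat \<Rightarrow> real" where w: "\<And>e. e \<in> pos ` E \<union> neg ` E \<Longrightarrow> e \<in> P \<longleftrightarrow> 0 \<le> (\<Sum>i<m. w i * real_of_int (e i))"
    by blast
  have mon: "eval_monomial d e = (\<Prod>i<m. d i ^ lookup e i)" if "e \<in> E" for e
    by (rule eval_monomial_superset) (use E(2)[OF that] in auto)
  show ?thesis
  proof (intro exI[of _ w] ballI conjI)
    fix e assume e: "e \<in> E"
    have "pos e \<in> P \<longleftrightarrow> eval_monomial d e \<in> Domain R"
      using mon[OF e] by (simp add: P_def pos_def)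
    with w[of "pos e"] e show "eval_monomial d e \<in> Domain R \<longleftrightarrow> 0 \<le> (\<Sum>i<m. w i * real (lookup e i))"
      by (simp add: pos_def)
    have "neg e \<in> P \<longleftrightarrow> inverse (eval_monomial d e) \<in> Domain R"
      using mon[OF e] by (simp add: P_def neg_def power_int_minus prod_inverse)
    with w[of "neg e"] e show "inverse (eval_monomial d e) \<in> Domain R \<longleftrightarrow> (\<Sum>i<m. w i * real (lookup e i)) \<le> 0"
      by (simp add: neg_def sum_negf)
  qed
qed

text \<open>
  The limits \<open>g'\<close> of \<open>u\<close> and \<open>c\<close> of \<open>d \<cdot> u\<close> share their part of weight zero up to torus factors,
  and \<open>d\<inverse> \<cdot> c\<close> specializes exactly to that part of \<open>g'\<close>.
\<close>

lemma specialize_torus_translate: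
  assumes d: "\<And>i. d i \<noteq> 0" and g': "g' \<in> polys m"
    and u: "\<And>e. (u e, lookup g' e) \<in> R" and du: "\<And>e. (u e * eval_monomial d e, c e) \<in> R"
  shows "\<exists>Q\<in>faces (NPT g'). \<forall>e.
    (emb (c e) * inverse (eval_monomial d e), lookup (restrict_to g' Q) e) \<in> R"
proof -
  have "\<exists>w :: nat \<Rightarrow> real. \<forall>e\<in>keys g'.
    (eval_monomial d e \<in> Domain R \<longleftrightarrow> 0 \<le> (\<Sum>i<m. w i * real (lookup e i))) \<and>
    (inverse (eval_monomial d e) \<in> Domain R \<longleftrightarrow> (\<Sum>i<m. w i * real (lookup e i)) \<le> 0)"
    by (rule torus_weights) (use d polysD[OF g'] in auto)
  then obtain w :: "nat \<Rightarrow> real" where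
    w: "\<And>e. e \<in> keys g' \<Longrightarrow> eval_monomial d e \<in> Domain R \<longleftrightarrow> 0 \<le> (\<Sum>i<m. w i * real (lookup e i))"
    "\<And>e. e \<in> keys g' \<Longrightarrow> inverse (eval_monomial d e) \<in> Domain R \<longleftrightarrow> (\<Sum>i<m. w i * real (lookup e i)) \<le> 0"
    by blast
  have nz: "eval_monomial d e \<noteq> 0" for e using d by (simp add: eval_monomial_def)
  \<comment> \<open>At a pole of the monomial, \<open>u e\<close> is the product of
    \<open>u e * eval_monomial d e\<close>, which has a residue, and an element of residue
    \<open>0\<close>; so \<open>e\<close> does not occur in \<open>g'\<close>.\<close>
  have in_Domain: "eval_monomial d e \<in> Domain R" if "e \<in> keys g'" for e
  proof (rule ccontr)
    assume "eval_monomial d e \<notin> Domain R"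
    from rel_mult[OF du[of e] not_in_Domain_inverse[OF this]] nz[of e] have "(u e, 0) \<in> R"
      by (simp add: mult.assoc)
    with u[of e] rel_unique have "lookup g' e = 0" by blast
    with that show False by (simp add: in_keys_iff)
  qed
  then have "0 \<le> (\<Sum>i<m. w i * real (lookup e i))" if "e \<in> keys g'" for e
    using w(1)[OF that] that by blast
  from NPT_weight_face[OF this] obtain Q where Q: "Q \<in> faces (NPT g')"
    "\<And>e. lookup (restrict_to g' Q) e = (if (\<Sum>i<m. w i * real (lookup e i)) = 0 then lookup g' e else 0)"
    by blast
  have "(emb (c e) * inverse (eval_monomial d e), lookup (restrict_to g' Q) e) \<in> R" for e
  \<comment> \<open>In the first case the residues satisfy \<open>lookup g' e = c e * b\<close>, and
    on the support of \<open>g'\<close> both bounds on the weight hold, so it is \<open>0\<close>.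
    In the second the monomial has residue \<open>0\<close>, which forces
    \<open>c e = 0\<close>.\<close>
  proof (cases "inverse (eval_monomial d e) \<in> Domain R")
    case True
    then obtain b where b: "(inverse (eval_monomial d e), b) \<in> R" by blast
    from rel_mult[OF du[of e] b] nz[of e] have "(u e, c e * b) \<in> R"
      by (simp add: mult.assoc)
    with u[of e] rel_unique have "lookup g' e = c e * b" by blast
    moreover have "lookup (restrict_to g' Q) e = lookup g' e"
    proof (cases "e \<in> keys g'")
      case e: True
      with w[OF e] in_Domain[OF e] True show ?thesis by (simp add: Q(2))
    qed (simp add: Q(2) in_keys_iff)
    ultimately show ?thesis using rel_mult[OF rel_emb b] by simp
  next
    case False
    from not_in_Domain_inverse[OF this] have "(eval_monomial d e, 0) \<in> R" by simp
    from rel_mult[OF u this] have "(u e * eval_monomial d e, 0) \<in> R" by simp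
    with du[of e] rel_unique have "c e = 0" by blast
    moreover have "lookup (restrict_to g' Q) e = 0"
      using w(2)[of e] False by (auto simp: Q(2) in_keys_iff)
    ultimately show ?thesis using rel_zero by (simp add: emb.hom_zero)
  qed
  with Q(1) show ?thesis by blast
qed

end

theorem stable_degeneration_face:
  fixes f g :: "(nat, 'a::alg_closed_field) mpoly"
  assumes g: "g \<in> polys m" and fg: "stable_degeneration m f g"
  obtains A M Q where "A \<in> SL m" "M \<in> SL m" "Q \<in> faces (NPT (act m A g))"
    "f = act m M (restrict_to (act m A g) Q)"
proof -
  from fg obtain h where h: "h \<in> polys m" and closed: "zariski_closed m (SL_orbit m h)"
    and closure: "SL_orbit m h \<subseteq> zariski_closure m (SL_orbit m g)" and f: "f \<in> SL_orbit m h"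
    unfolding stable_degeneration_def by blast
  define T where "T = SL_orbit m h"
  from f closure have "f \<in> zariski_closure m (SL_orbit m g)" by blast
  from place_of_closure_point[OF g this] obtain R where R: "maximal_place const_fract R"
    and X: "\<And>e. (lookup (act m (generic_SL m) (Poly_Mapping.map const_fract g)) e, lookup f e) \<in> R"
    by blast
  interpret maximal_place const_fract R by (rule R)
  interpret stable_points "const_fract :: 'a \<Rightarrow> (nat, 'a) mpoly fract" m T
    by unfold_locales (auto simp: T_def act_in_SL_orbit[OF h] dest: subsetD[OF SL_orbit_subset_polys])
  define gK where "gK = Poly_Mapping.map const_fract g"
  have gK: "gK \<in> polys m" unfolding gK_def by (rule emb.map_hom_in_polys[OF g])
  have gK_g: "(gK, g) \<in> coeff_rel"
    unfolding gK_def by (rule coeff_relI) (simp add: emb.lookup_map_hom rel_emb)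
  have Xc: "(generic_SL m :: (nat, 'a) mpoly fract mat) \<in> carrier_mat m m" "det (generic_SL m :: (nat, 'a) mpoly fract mat) = 1"
    using generic_SL_in_SL by (auto simp: SL_def)
  from V.diagonalize[OF Xc(1)] obtain A D B where AB: "A \<in> V.integral_SL m" "B \<in> V.integral_SL m"
    and D: "D \<in> carrier_mat m m" "\<And>i j. i < m \<Longrightarrow> j < m \<Longrightarrow> i \<noteq> j \<Longrightarrow> D $$ (i, j) = 0"
    and ADB: "generic_SL m = A * D * B" by blast
  obtain B' where B': "B' \<in> V.integral_SL m" "B * B' = 1\<^sub>m m"
    by (rule integral_SL_inverse[OF AB(2)])
  have c: "A \<in> carrier_mat m m" "B \<in> carrier_mat m m" "B' \<in> carrier_mat m m"
    and dets: "det A = 1" "det B = 1"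
    using AB B' by (auto simp: V.integral_SL_def SL_def)
  have rel: "(C $$ (i, j), residue_mat m C $$ (i, j)) \<in> R" if "C \<in> V.integral_SL m" "i < m" "j < m" for C i j
    using that by (intro rel_residue_mat) (auto simp: V.integral_SL_def)
  have "generic_SL m * B' = A * D * (B * B')"
    unfolding ADB using c D(1) by (simp add: assoc_mult_mat[of _ m m _ m _ m])
  \<comment> \<open>The integral factor \<open>B\<close> moves to the side of \<open>f\<close>,
    where its inverse only replaces \<open>f\<close> by another point \<open>q\<close> of
    \<open>T\<close>, the \<open>c\<close> of the overview.\<close>
  then have XB: "generic_SL m * B' = A * D" using B'(2) c D(1) right_mult_one_mat[of "A * D" m m] by simp
  define u where "u = act m A gK"
  define g' where "g' = act m (residue_mat m A) g"
  define q where "q = act m (residue_mat m B') f"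
  have f_polys: "f \<in> polys m" using f SL_orbit_subset_polys by blast
  have q: "q \<in> T" unfolding q_def
    by (rule stable) (use f B' in \<open>auto simp: T_def residue_mat_in_SL\<close>)
  have u_g': "(u, g') \<in> coeff_rel"
    unfolding u_def g'_def by (rule coeff_rel_act[OF gK_g rel[OF AB(1)] gK g])
  have "act m B' (act m (generic_SL m) gK) = act m D u"
    unfolding u_def using act_act[OF Xc(1) c(3) gK] act_act[OF c(1) D(1) gK] XB by simp
  moreover have "(act m (generic_SL m) gK, f) \<in> coeff_rel"
    using X by (intro coeff_relI) (simp add: gK_def)
  from coeff_rel_act[OF this rel[OF B'(1)] act_in_polys f_polys]
  have "(act m B' (act m (generic_SL m) gK), q) \<in> coeff_rel" unfolding q_def .
  ultimately have Du_q: "(act m D u, q) \<in> coeff_rel" by simp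
  \<comment> \<open>The value \<open>1\<close> beyond \<open>m\<close> keeps all monomials in
    \<open>d\<close> nonzero and meets the condition of \<open>base_change_torus\<close>.\<close>
  define d where "d = (\<lambda>i. if i < m then D $$ (i, i) else 1)"
  have Du: "lookup (act m D u) e = lookup u e * eval_monomial d e" for e
    by (rule lookup_act_diagonal) (auto simp: u_def act_in_polys d_def D(2))
  have "det D = 1"
    using det_mult[of "A * D" m B] det_mult[of A m D] c D(1) dets Xc(2) by (simp add: ADB)
  moreover have "det D = (\<Prod>i<m. d i)"
  proof -
    have "det D = prod_list (diag_mat D)"
      by (rule det_upper_triangular[of _ m]) (use D in \<open>auto simp: upper_triangular_def\<close>)
    then show ?thesis using D(1) by (simp add: prod_list_diag_prod d_def lessThan_atLeast0)
  qed
  ultimately have d1: "(\<Prod>i<m. d i) = 1" by simp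
  have d0: "d i \<noteq> 0" for i
  proof (cases "i < m")
    case True
    with d1 show ?thesis by (metis finite_lessThan lessThan_iff prod_zero zero_neq_one)
  qed (simp add: d_def)
  have g'_polys: "g' \<in> polys m" by (simp add: g'_def act_in_polys)
  have "\<exists>Q\<in>faces (NPT g'). \<forall>e.
    (const_fract (lookup q e) * inverse (eval_monomial d e), lookup (restrict_to g' Q) e) \<in> R"
    by (rule specialize_torus_translate[of d g' m "lookup u"])
       (rule d0 g'_polys coeff_relD[OF u_g'] coeff_relD[OF Du_q, unfolded Du])+
  then obtain Q where Q: "Q \<in> faces (NPT g')"
    and lim: "\<And>e. (const_fract (lookup q e) * inverse (eval_monomial d e), lookup (restrict_to g' Q) e) \<in> R"
    by blast
  define r where "r = restrict_to g' Q"
  have "(\<lambda>e. const_fract (lookup q e) * eval_monomial (\<lambda>i. inverse (d i)) e) \<in> base_change"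
    by (rule base_change_torus) (use d1 q in \<open>auto simp: prod_inverse in_base_change d_def\<close>)
  moreover have "eval_monomial (\<lambda>i. inverse (d i)) e = inverse (eval_monomial d e)" for e
    by (simp add: eval_monomial_def power_inverse prod_inverse)
  ultimately have bc: "(\<lambda>e. const_fract (lookup q e) * inverse (eval_monomial d e)) \<in> base_change"
    by simp
  \<comment> \<open>An equation of \<open>T\<close> vanishes at the translate of \<open>q\<close>
    over the function field. The place sends this value to its value at \<open>r\<close>, which is
    therefore \<open>0\<close>.\<close>
  have "r \<in> T"
  proof -
    from closed obtain P where P: "T = {f \<in> polys m. \<forall>\<Phi>\<in>P. eval_mpoly (\<lambda>c. c) (lookup f) \<Phi> = 0}"
      unfolding zariski_closed_def T_def by blast
    have "eval_mpoly (\<lambda>c. c) (lookup r) \<Phi> = 0" if "\<Phi> \<in> P" for \<Phi>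
    proof -
      have "eval_mpoly const_fract (\<lambda>e. const_fract (lookup q e) * inverse (eval_monomial d e)) \<Phi> = 0"
        using bc that P unfolding base_change_def by blast
      moreover from rel_eval_mpoly[where \<phi> = const_fract and \<psi> = "\<lambda>c. c" and f = \<Phi> and g = \<Phi>,
          OF emb.hom_zero refl rel_emb lim]
      have "(eval_mpoly const_fract (\<lambda>e. const_fract (lookup q e) * inverse (eval_monomial d e)) \<Phi>,
        eval_mpoly (\<lambda>c. c) (lookup r) \<Phi>) \<in> R" unfolding r_def .
      ultimately show ?thesis using rel_zero_left by metis
    qed
    moreover have "r \<in> polys m"
    proof (rule polysI)
      fix e assume "e \<in> keys r"
      then have "e \<in> keys g'" by (auto simp: r_def lookup_restrict_to in_keys_iff split: if_splits)
      then show "keys e \<subseteq> {..<m}" by (rule polysD[OF g'_polys])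
    qed
    ultimately show ?thesis unfolding P by blast
  qed
  then obtain M where "M \<in> SL m" "f = act m M r"
    unfolding T_def by (rule SL_orbit_connected[OF h f])
  with Q residue_mat_in_SL[OF AB(1)] show thesis unfolding r_def g'_def by (intro that)
qed

section \<open>Circuits\<close>

lemma poly_bounded_mono: "poly_bounded t \<Longrightarrow> (\<And>n. s n \<le> t n) \<Longrightarrow> poly_bounded s"
  unfolding poly_bounded_def by (blast intro: order.trans)

lemma poly_bounded_add: "poly_bounded s \<Longrightarrow> poly_bounded t \<Longrightarrow> poly_bounded (\<lambda>n. s n + t n)"
proof -
  assume "poly_bounded s" "poly_bounded t"
  then obtain p q where "\<And>n. s n \<le> poly p n" "\<And>n. t n \<le> poly q n"
    unfolding poly_bounded_def by blast
  then have "\<forall>n. s n + t n \<le> poly (p + q) n" by (simp add: add_mono)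
  then show ?thesis unfolding poly_bounded_def ..
qed

lemma poly_bounded_mult: "poly_bounded s \<Longrightarrow> poly_bounded t \<Longrightarrow> poly_bounded (\<lambda>n. s n * t n)"
proof -
  assume "poly_bounded s" "poly_bounded t"
  then obtain p q where "\<And>n. s n \<le> poly p n" "\<And>n. t n \<le> poly q n"
    unfolding poly_bounded_def by blast
  then have "\<forall>n. s n * t n \<le> poly (p * q) n" by (simp add: mult_le_mono)
  then show ?thesis unfolding poly_bounded_def ..
qed

lemma poly_bounded_const: "poly_bounded (\<lambda>n. c)"
  unfolding poly_bounded_def by (intro exI[of _ "[:c:]"]) simp

definition gate_vals :: "(nat, 'a) mpoly list \<Rightarrow> 'a gate list \<Rightarrow> (nat, 'a::comm_ring_1) mpoly list" where
  "gate_vals = foldl (\<lambda>vs g. vs @ [gate_val vs g])"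

lemma gate_vals_Nil [simp]: "gate_vals vs [] = vs"
  and gate_vals_append: "gate_vals vs (c @ c') = gate_vals (gate_vals vs c) c'"
  and gate_vals_snoc: "gate_vals vs (c @ [g]) = gate_vals vs c @ [gate_val (gate_vals vs c) g]"
  by (simp_all add: gate_vals_def)

lemma length_gate_vals [simp]: "length (gate_vals vs c) = length vs + length c"
  by (induction c rule: rev_induct) (simp_all add: gate_vals_snoc)

text \<open>Circuits relative to a list of values already available, so that they can be
  concatenated. \<open>k\<close> only bounds the number of gates.\<close>

definition computes :: "nat \<Rightarrow> (nat, 'a) mpoly list \<Rightarrow> nat \<Rightarrow> (nat, 'a::comm_ring_1) mpoly list \<Rightarrow> bool" where
  "computes m vs k ws \<longleftrightarrow> (\<exists>c. length c \<le> k \<and> gate_vals vs c = ws \<and>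
     (\<forall>i<length c. wf_gate m (length vs + i) (c ! i)))"

lemma computes_refl: "computes m vs 0 vs"
  unfolding computes_def by auto

lemma computes_trans:
  assumes "computes m vs k ws" "computes m ws l us"
  shows "computes m vs (k + l) us"
proof -
  from assms obtain c c' where c: "length c \<le> k" "gate_vals vs c = ws"
    "\<And>i. i < length c \<Longrightarrow> wf_gate m (length vs + i) (c ! i)" "length c' \<le> l" "gate_vals ws c' = us"
    "\<And>i. i < length c' \<Longrightarrow> wf_gate m (length ws + i) (c' ! i)"
    unfolding computes_def by blast
  have "wf_gate m (length vs + i) ((c @ c') ! i)" if "i < length (c @ c')" for i
    using c(3)[of i] c(6)[of "i - length c"] that by (auto simp: nth_append simp flip: c(2))
  with c show ?thesis unfolding computes_def
    by (intro exI[of _ "c @ c'"]) (auto simp: gate_vals_append)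
qed

lemma computes_gate: "wf_gate m (length vs) g \<Longrightarrow> computes m vs 1 (vs @ [gate_val vs g])"
  unfolding computes_def by (intro exI[of _ "[g]"]) (simp add: gate_vals_def)

lemma computes_Var: "v < m \<Longrightarrow> computes m vs 1 (vs @ [Var v])"
  using computes_gate[of m vs "Input v"] by simp

lemma computes_Const: "computes m vs 1 (vs @ [Const c])"
  using computes_gate[of m vs "Scalar c"] by simp

lemma computes_add:
  assumes "p \<in> set vs" "q \<in> set vs"
  shows "computes m vs 1 (vs @ [p + q])"
proof -
  from assms obtain i j where "i < length vs" "j < length vs" "p = vs ! i" "q = vs ! j"
    by (metis in_set_conv_nth)
  then show ?thesis using computes_gate[of m vs "Add i j"] by simp
qed

lemma computes_mult:
  assumes "p \<in> set vs" "q \<in> set vs"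
  shows "computes m vs 1 (vs @ [p * q])"
proof -
  from assms obtain i j where "i < length vs" "j < length vs" "p = vs ! i" "q = vs ! j"
    by (metis in_set_conv_nth)
  then show ?thesis using computes_gate[of m vs "Mult i j"] by simp
qed

text \<open>One gate for the empty sum and four for each term: coefficient, variable, product,
  sum.\<close>

lemma computes_linear_combination:
  assumes "t \<le> m"
  shows "\<exists>ws. computes m vs (1 + t * 4) ws \<and> set vs \<subseteq> set ws \<and> (\<Sum>j<t. Const (a j) * Var j) \<in> set ws"
  using assms
proof (induction t)
  case 0
  show ?case using computes_Const[of m vs 0]
    by (intro exI[of _ "vs @ [Const 0]"]) auto
next
  case (Suc t)
  then obtain ws where ws: "computes m vs (1 + t * 4) ws" "set vs \<subseteq> set ws"
    "(\<Sum>j<t. Const (a j) * Var j) \<in> set ws" by auto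
  let ?w1 = "ws @ [Const (a t)]"
  let ?w2 = "?w1 @ [Var t]"
  let ?w3 = "?w2 @ [Const (a t) * Var t]"
  let ?w4 = "?w3 @ [(\<Sum>j<t. Const (a j) * Var j) + Const (a t) * Var t]"
  have 1: "computes m vs (1 + t * 4 + 1) ?w1"
    by (rule computes_trans[OF ws(1) computes_Const])
  have 2: "computes m ?w1 1 ?w2"
    by (rule computes_Var) (use Suc.prems in simp)
  have 3: "computes m ?w2 1 ?w3"
    by (rule computes_mult) auto
  have 4: "computes m ?w3 1 ?w4"
    by (rule computes_add) (use ws(3) in auto)
  from computes_trans[OF computes_trans[OF computes_trans[OF 1 2] 3] 4]
  have "computes m vs (1 + Suc t * 4) ?w4" by (simp add: eval_nat_numeral)
  then show ?case using ws(2) by (intro exI[of _ ?w4]) auto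
qed

lemma computes_linear_forms:
  "\<exists>ws. computes m vs (t * (1 + m * 4)) ws \<and> set vs \<subseteq> set ws \<and> (\<forall>i<t. linear_form m M i \<in> set ws)"
proof (induction t)
  case 0
  show ?case using computes_refl by auto
next
  case (Suc t)
  then obtain ws where ws: "computes m vs (t * (1 + m * 4)) ws" "set vs \<subseteq> set ws"
    "\<forall>i<t. linear_form m M i \<in> set ws" by blast
  from computes_linear_combination[OF order.refl, of m ws "\<lambda>j. M $$ (t, j)"]
  obtain us where us: "computes m ws (1 + m * 4) us" "set ws \<subseteq> set us" "linear_form m M t \<in> set us"
    unfolding linear_form_def by blast
  from computes_trans[OF ws(1) us(1)] have "computes m vs (Suc t * (1 + m * 4)) us"
    by (simp only: mult_Suc add.commute)
  with ws us show ?case by (auto simp: less_Suc_eq)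
qed

text \<open>Each gate is replaced by exactly one gate, which keeps the values in order and the
  output last. An input becomes a copy of a value of \<open>s\<close>, made by adding
  \<open>0\<close>; hence \<open>0\<close> must be available.\<close>

lemma computes_simulation:
  assumes "\<forall>i<length c. wf_gate m (i) (c ! i)" "0 \<in> set ws" "\<And>i. i < m \<Longrightarrow> s i \<in> set ws"
  shows "computes k ws (length c) (ws @ map (subst s) (gate_vals [] c))"
  using assms(1)
proof (induction c rule: rev_induct)
  case Nil
  show ?case using computes_refl by simp
next
  case (snoc g c)
  let ?vs = "gate_vals [] c"
  let ?us = "ws @ map (subst s) ?vs"
  have c: "\<forall>i<length c. wf_gate m i (c ! i)" using snoc.prems by (auto simp: nth_append dest: spec[of _ "_"] less_SucI)
  have g: "wf_gate m (length c) g" using snoc.prems by (auto dest: spec[of _ "length c"])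
  have "computes k ?us 1 (?us @ [subst s (gate_val ?vs g)])"
  proof (cases g)
    case (Input v)
    with g assms have "s v \<in> set ?us" "0 \<in> set ?us" by auto
    from computes_add[OF this] Input show ?thesis by simp
  next
    case (Scalar a)
    then show ?thesis using computes_Const[of k ?us a] by simp
  next
    case (Add i j)
    with g have "subst s (?vs ! i) \<in> set ?us" "subst s (?vs ! j) \<in> set ?us" by auto
    from computes_add[OF this] Add show ?thesis by (simp add: subst_hom.hom_add)
  next
    case (Mult i j)
    with g have "subst s (?vs ! i) \<in> set ?us" "subst s (?vs ! j) \<in> set ?us" by auto
    from computes_mult[OF this] Mult show ?thesis by (simp add: subst_hom.hom_mult)
  qed
  from computes_trans[OF snoc.IH[OF c] this] show ?case by (simp add: gate_vals_snoc)
qed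

lemma circuit_act:
  assumes c: "wf_circuit m c" and f: "circuit_val c \<in> polys m"
  shows "\<exists>c'. wf_circuit m c' \<and> circuit_val c' = act m M (circuit_val c) \<and>
    length c' \<le> 1 + m * (1 + m * 4) + length c"
proof -
  \<comment> \<open>The starting list supplies the \<open>0\<close> with which the simulation copies
    inputs.\<close>
  from computes_linear_forms[of m "[Const 0]" m M] obtain ws where
    ws: "computes m [Const 0] (m * (1 + m * 4)) ws" "set [Const 0] \<subseteq> set ws"
      "\<forall>i<m. linear_form m M i \<in> set ws" by blast
  have "computes m [] 1 [Const 0]" using computes_Const[of m "[]" 0] by simp
  from computes_trans[OF this ws(1)] have "computes m [] (1 + m * (1 + m * 4)) ws" .
  moreover have "computes m ws (length c) (ws @ map (subst (linear_form m M)) (gate_vals [] c))"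
    by (rule computes_simulation) (use c ws in \<open>auto simp: wf_circuit_def\<close>)
  ultimately have "computes m [] (1 + m * (1 + m * 4) + length c)
    (ws @ map (subst (linear_form m M)) (gate_vals [] c))" by (rule computes_trans)
  then obtain c' where c': "length c' \<le> 1 + m * (1 + m * 4) + length c"
    "gate_vals [] c' = ws @ map (subst (linear_form m M)) (gate_vals [] c)"
    "\<forall>i<length c'. wf_gate m i (c' ! i)" unfolding computes_def by auto
  have ne: "gate_vals [] c \<noteq> []"
    using c unfolding wf_circuit_def by (metis add_0 length_0_conv length_gate_vals)
  have "c' \<noteq> []" using c'(2) ne by auto
  with c'(3) have "wf_circuit m c'" by (simp add: wf_circuit_def)
  moreover have "circuit_val c' = act m M (circuit_val c)"
    using c'(2) ne unfolding circuit_val_def gate_vals_def[symmetric] act_def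
    by (simp add: last_map)
  ultimately show ?thesis using c'(1) by blast
qed

lemma p_bounded_act:
  assumes "p_bounded f"
  shows "p_bounded (\<lambda>n. (nvars f n, act (nvars f n) (M n) (member f n)))"
  using assms unfolding p_bounded_def fst_conv snd_conv
  by (intro conjI allI act_in_polys poly_bounded_mono[OF _ total_degree_act_le]) blast+

lemma VP_act:
  assumes "f \<in> VP"
  shows "(\<lambda>n. (nvars f n, act (nvars f n) (M n) (member f n))) \<in> VP"
proof -
  from assms obtain c where f: "p_bounded f" and c: "poly_bounded (\<lambda>n. length (c n))"
    "\<And>n. wf_circuit (nvars f n) (c n)" "\<And>n. circuit_val (c n) = member f n"
    by (auto simp: VP_def)
  have "\<exists>c'. wf_circuit (nvars f n) c' \<and> circuit_val c' = act (nvars f n) (M n) (member f n) \<and>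
    length c' \<le> 1 + nvars f n * (1 + nvars f n * 4) + length (c n)" for n
    using circuit_act[OF c(2)[of n], of "M n"] f by (simp add: c(3) p_bounded_def)
  then obtain c' where c': "\<And>n. wf_circuit (nvars f n) (c' n)"
    "\<And>n. circuit_val (c' n) = act (nvars f n) (M n) (member f n)"
    "\<And>n. length (c' n) \<le> 1 + nvars f n * (1 + nvars f n * 4) + length (c n)" by metis
  have "poly_bounded (nvars f)" using f by (simp add: p_bounded_def)
  then have "poly_bounded (\<lambda>n. 1 + nvars f n * (1 + nvars f n * 4) + length (c n))"
    by (intro poly_bounded_add poly_bounded_mult poly_bounded_const c(1))
  from poly_bounded_mono[OF this c'(3)] c' p_bounded_act[OF f, of M] show ?thesis
    by (auto simp: VP_def)
qed

lemma subst_linear_form_fixed: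
  "subst (\<lambda>i. if i < m then Var i else t i) (linear_form m M i) = linear_form m M i"
proof -
  have "subst (\<lambda>i. if i < m then Var i else t i) (linear_form m M i) = subst Var (linear_form m M i)"
    by (rule subst_cong_polys[OF linear_form_in_polys]) simp
  then show ?thesis by (simp add: subst_Var_id)
qed

text \<open>\<open>N\<close> is block diagonal, with \<open>M\<close> on the variables of
  \<open>f\<close> and the identity on the summation variables. The action then commutes with every
  assignment to the latter, and so with the sum.\<close>

lemma VNP_act:
  fixes f :: "'a::comm_ring_1 family"
  assumes "f \<in> VNP"
  shows "(\<lambda>n. (nvars f n, act (nvars f n) (M n) (member f n))) \<in> VNP"
proof -
  define s where "s = (\<lambda>n (w :: nat \<Rightarrow> 'a) i. if i < nvars f n then Var i else Const (w i))"
  from assms obtain g where f: "p_bounded f" and g: "g \<in> VP" "\<And>n. nvars f n \<le> nvars g n"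
    "\<And>n. member f n = (\<Sum>w\<in>{nvars f n..<nvars g n} \<rightarrow>\<^sub>E {0, 1}. subst (s n w) (member g n))"
    by (auto simp: VNP_def s_def)
  define N where "N = (\<lambda>n. mat (nvars g n) (nvars g n) (\<lambda>(i, j).
    if i < nvars f n then if j < nvars f n then M n $$ (i, j) else 0 else if i = j then 1 else 0))"
  define g' where "g' = (\<lambda>n. (nvars g n, act (nvars g n) (N n) (member g n)))"
  have g': "g' \<in> VP" unfolding g'_def by (rule VP_act[OF g(1)])
  have eq: "act (nvars f n) (M n) (subst (s n w) (member g n)) = subst (s n w) (member g' n)" for n w
  proof -
    let ?m = "nvars f n" and ?k = "nvars g n"
    have "member g n \<in> polys ?k" using g(1) by (auto simp: VP_def p_bounded_def)
    moreover have "subst (linear_form ?m (M n)) (s n w i) = subst (s n w) (linear_form ?k (N n) i)"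
      if i: "i < ?k" for i
    proof (cases "i < ?m")
      case True
      have "linear_form ?k (N n) i = linear_form ?m (M n) i"
        unfolding linear_form_def
        by (rule sum.mono_neutral_cong_right) (use True i g(2)[of n] in \<open>auto simp: N_def\<close>)
      then show ?thesis using True by (simp add: s_def subst_linear_form_fixed)
    next
      case False
      have "linear_form ?k (N n) i = Const 1 * Var i"
        by (rule linear_form_diagonal) (use False i in \<open>auto simp: N_def\<close>)
      then show ?thesis using False by (simp add: s_def)
    qed
    ultimately show ?thesis
      unfolding g'_def act_def snd_conv subst_subst by (rule subst_cong_polys)
  qed
  have sum: "act (nvars f n) (M n) (member f n) =
    (\<Sum>w\<in>{nvars f n..<nvars g n} \<rightarrow>\<^sub>E {0, 1}. subst (s n w) (member g' n))" for n
  proof -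
    have "act (nvars f n) (M n) (member f n) =
      (\<Sum>w\<in>{nvars f n..<nvars g n} \<rightarrow>\<^sub>E {0, 1}. act (nvars f n) (M n) (subst (s n w) (member g n)))"
      unfolding g(3) act_def by (rule subst_hom.hom_sum)
    then show ?thesis by (simp only: eq)
  qed
  show ?thesis
    unfolding VNP_def mem_Collect_eq
  proof (intro conjI bexI[OF _ g'] allI p_bounded_act[OF f])
    fix n
    have nv: "nvars g' n = nvars g n" by (simp add: g'_def)
    show "nvars (\<lambda>n. (nvars f n, act (nvars f n) (M n) (member f n))) n \<le> nvars g' n"
      using g(2)[of n] by (simp only: nv fst_conv)
    show "member (\<lambda>n. (nvars f n, act (nvars f n) (M n) (member f n))) n =
      (\<Sum>w\<in>{nvars (\<lambda>n. (nvars f n, act (nvars f n) (M n) (member f n))) n..<nvars g' n} \<rightarrow>\<^sub>E {0, 1}.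
        subst (\<lambda>i. if i < nvars (\<lambda>n. (nvars f n, act (nvars f n) (M n) (member f n))) n
          then Var i else Const (w i)) (member g' n))"
      unfolding nv fst_conv snd_conv sum[unfolded s_def] ..
  qed
qed

lemma SL_invariantI:
  assumes "\<And>f M. f \<in> C \<Longrightarrow> (\<lambda>n. (nvars f n, act (nvars f n) (M n) (member f n))) \<in> C"
  shows "SL_invariant C"
  unfolding SL_invariant_def SL_act_eq
proof (intro ballI allI impI)
  fix g \<sigma> assume "g \<in> C"
  from assms[OF this, of "\<lambda>n. the (mat_inverse (\<sigma> n))"]
  show "(\<lambda>n. (nvars g n, act (nvars g n) (the (mat_inverse (\<sigma> n))) (member g n))) \<in> C" .
qed

lemma SL_invariant_VP: "SL_invariant VP"
  by (rule SL_invariantI) (rule VP_act)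

lemma SL_invariant_VNP: "SL_invariant VNP"
  by (rule SL_invariantI) (rule VNP_act)

section \<open>Stable and Newton degenerations\<close>

lemma linear_form_affine: "linear_form k M i \<in> affine_forms k"
  unfolding affine_forms_def linear_form_def
  by (intro CollectI exI[of _ 0] exI[of _ "\<lambda>j. M $$ (i, j)"]) simp

lemma linear_projection_act: "linear_projection m (act m M f) m f"
  unfolding linear_projection_def act_def using linear_form_affine by blast

lemma total_degree_restrict_to_le: "total_degree (restrict_to f Q) \<le> total_degree f"
  unfolding total_degree_le_iff
  by (auto simp: lookup_restrict_to in_keys_iff split: if_splits intro!: monomial_degree_le_total_degree)

lemma NPT_in_faces: "NPT f \<in> faces (NPT f)"
  unfolding faces_def by (intro CollectI exI[of _ "\<lambda>_. 0"] exI[of _ 0]) (auto simp: linear_zero)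

lemma restrict_to_NPT: "restrict_to f (NPT f) = f"
proof (rule poly_mapping_eqI)
  fix e
  have "exponent_vector e \<in> NPT f" if "lookup f e \<noteq> 0"
    unfolding NPT_def using that by (intro hull_inc) (auto simp: in_keys_iff)
  then show "lookup (restrict_to f (NPT f)) e = lookup f e" by (auto simp: lookup_restrict_to)
qed

theorem Stable_subset_Newton:
  fixes C :: "'a::alg_closed_field family set"
  assumes C: "C \<subseteq> Collect p_bounded" and inv: "SL_invariant C"
  shows "Stable C \<subseteq> Newton C"
proof
  fix f assume f: "f \<in> Stable C"
  show "f \<in> Newton C"
  proof (cases "f \<in> C")
    case True
    have "\<forall>n. \<exists>Q\<in>faces (NPT (member f n)).
      (nvars f n = nvars f n \<and> member f n = restrict_to (member f n) Q) \<or>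
      linear_projection (nvars f n) (member f n) (nvars f n) (restrict_to (member f n) Q)"
      by (intro allI bexI[OF _ NPT_in_faces] disjI1) (simp add: restrict_to_NPT)
    with True C show ?thesis unfolding Newton_def by blast
  next
    case False
    with f obtain g where g: "g \<in> C" "\<And>n. nvars f n = nvars g n"
      "\<And>n. stable_degeneration (nvars f n) (member f n) (member g n)"
      unfolding Stable_def by blast
    from g(1) C have pg: "p_bounded g" by blast
    have "\<exists>A M Q. A \<in> SL (nvars g n) \<and> Q \<in> faces (NPT (act (nvars g n) A (member g n))) \<and>
      member f n = act (nvars g n) M (restrict_to (act (nvars g n) A (member g n)) Q)" for n
    proof -
      have "member g n \<in> polys (nvars g n)" using pg by (simp add: p_bounded_def)
      from stable_degeneration_face[OF this g(3)[of n, unfolded g(2)]] show ?thesis by metis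
    qed
    then obtain A M Q where AMQ: "\<And>n. A n \<in> SL (nvars g n)"
      "\<And>n. Q n \<in> faces (NPT (act (nvars g n) (A n) (member g n)))"
      "\<And>n. member f n = act (nvars g n) (M n) (restrict_to (act (nvars g n) (A n) (member g n)) (Q n))"
      by metis
    \<comment> \<open>\<open>SL_act\<close> inverts its matrix, so \<open>act\<close> by
      \<open>A n\<close> is \<open>SL_act\<close> by the inverse of \<open>A n\<close>. In this form
      \<open>SL_invariant\<close> puts the translated family, whose polytopes carry the faces, into
      \<open>C\<close>.\<close>
    define \<sigma> where "\<sigma> = (\<lambda>n. the (mat_inverse (A n)))"
    have \<sigma>: "\<sigma> n \<in> SL (nvars g n)" "SL_act (nvars g n) (\<sigma> n) (member g n) = act (nvars g n) (A n) (member g n)" for n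
      using AMQ(1)[of n] by (simp_all add: \<sigma>_def SL_mat_inverse SL_act_eq SL_mat_inverse_mat_inverse)
    define g' where "g' = (\<lambda>n. (nvars g n, act (nvars g n) (A n) (member g n)))"
    have "g' \<in> C"
    proof -
      have "(\<lambda>n. (nvars g n, SL_act (nvars g n) (\<sigma> n) (member g n))) \<in> C"
        using inv g(1) \<sigma>(1) unfolding SL_invariant_def by blast
      then show ?thesis by (simp only: \<sigma>(2) g'_def)
    qed
    moreover have "p_bounded f"
    proof -
      have "member f n \<in> polys (nvars f n)" for n by (simp only: AMQ(3) g(2) act_in_polys)
      moreover have "total_degree (member f n) \<le> total_degree (member g n)" for n
        unfolding AMQ(3)
        by (intro order.trans[OF total_degree_act_le] order.trans[OF total_degree_restrict_to_le] total_degree_act_le)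
      moreover have "nvars f = nvars g" using g(2) by blast
      ultimately show ?thesis using pg unfolding p_bounded_def
        by (metis poly_bounded_mono)
    qed
    moreover have "linear_projection (nvars f n) (member f n) (nvars g' n) (restrict_to (member g' n) (Q n))"
      and "Q n \<in> faces (NPT (member g' n))" for n
      using AMQ(2)[of n] linear_projection_act unfolding AMQ(3) g(2) g'_def snd_conv fst_conv by blast+
    ultimately show ?thesis unfolding Newton_def by blast
  qed
qed

lemma VP_p_bounded: "VP \<subseteq> Collect p_bounded" and VNP_p_bounded: "VNP \<subseteq> Collect p_bounded"
  by (auto simp: VP_def VNP_def)

theorem theorem4p1:
  shows "(\<forall>C :: 'a::alg_closed_field family set.
            C \<subseteq> Collect p_bounded \<longrightarrow> SL_invariant C \<longrightarrow> Stable C \<subseteq> Newton C)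
       \<and> Stable (VP :: 'a family set) \<subseteq> Newton VP
       \<and> Stable (VNP :: 'a family set) \<subseteq> Newton VNP"
  using Stable_subset_Newton Stable_subset_Newton[OF VP_p_bounded SL_invariant_VP]
    Stable_subset_Newton[OF VNP_p_bounded SL_invariant_VNP] by blast

end
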